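(* Let $s\ge1$ be an integer. For all integers $k\ge\frac32 s$, the HBVM$(k,s)$ method is energy-conserving and of order $2s$ when used for solving the Hamiltonian problem $$\frac{d}{dt}\begin{pmatrix}\boldsymbol q\\ \boldsymbol p\end{pmatrix}=\left(|J_2|\otimes D\otimes J_2^\top\right)\nabla H(\boldsymbol q,\boldsymbol p)=\begin{pmatrix}(D\otimes J_2^\top)\boldsymbol p\\ (D\otimes J_2^\top)\left[(D^2\otimes I_2)\boldsymbol q+\int_a^b\boldsymbol\omega(x)\left(\hat u_0+\boldsymbol\omega(x)^\top\boldsymbol q\right)^2dx\right]\end{pmatrix},$$ with Hamiltonian $$H(\boldsymbol q,\boldsymbol p)=\frac12\left[\boldsymbol p^\top\boldsymbol p+\boldsymbol q^\top(D^2\otimes I_2)\boldsymbol q+\frac23\int_a^b\left(\hat u_0+\boldsymbol\omega(x)^\top\boldsymbol q\right)^3dx\right].$$ That is, writing $y=(\boldsymbol q,\boldsymbol p)$, if $y_1$ is the approximation produced from $y_0$ by one step of size $h$ and $y(h)$ is the exact solution with $y(0)=y_0$, then $H(y_1)=H(y_0)$, and $y_1-y(h)=O(h^{2s+1})$ as $h\to0$.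
   Context: Problem data: $a<b$ and $\hat u_0$ are real numbers, $N\ge1$ is an integer, $\boldsymbol q,\boldsymbol p\in\mathbb R^{2N}$, and $\boldsymbol\omega(x)=(s_1(x),c_1(x),\dots,s_N(x),c_N(x))^\top$ with $$c_j(x)=\sqrt{\frac{2}{b-a}}\cos\left(2\pi j\frac{x-a}{b-a}\right),\qquad s_j(x)=\sqrt{\frac{2}{b-a}}\sin\left(2\pi j\frac{x-a}{b-a}\right).$$ $D=\frac{2\pi}{b-a}\mathrm{diag}(1,\dots,N)$, $I_2$ is the $2\times2$ identity, $J_2=\begin{pmatrix}0&1\\-1&0\end{pmatrix}$, $|J_2|=\begin{pmatrix}0&1\\1&0\end{pmatrix}$, and $\otimes$ is the Kronecker product. Method: for integers $k\ge s\ge1$, HBVM$(k,s)$ (Hamiltonian Boundary Value Method) is the $k$-stage Runge-Kutta method with abscissae $c_1,\dots,c_k$ and weights $b_1,\dots,b_k$ given by the nodes and weights of the $k$-point Gauss-Legendre quadrature formula on $[0,1]$ (of order $2k$), and with $k\times k$ coefficient matrix $A=\mathcal I_s\mathcal P_s^\top\Omega$, where $\Omega=\mathrm{diag}(b_1,\dots,b_k)$, $\mathcal P_s$ and $\mathcal I_s$ are the $k\times s$ matrices with entries $(\mathcal P_s)_{ij}=P_{j-1}(c_i)$ and $(\mathcal I_s)_{ij}=\int_0^{c_i}P_{j-1}(x)\,dx$, and $P_0,P_1,\dots$ are the Legendre polynomials shifted and scaled so as to be orthonormal on $[0,1]$ ($\deg P_j=j$). (The abscissae $c_i$ are not to be confused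 with the functions $c_j(x)$.) Applied to $\dot y=f(y)$, $y(0)=y_0$, with stepsize $h$, it defines $Y_i=y_0+h\sum_{j=1}^kA_{ij}f(Y_j)$, $i=1,\dots,k$, and $y_1=y_0+h\sum_{i=1}^kb_if(Y_i)$. As usual for implicit Runge-Kutta methods, $y_1$ is computed from a solution of the stage equations; for the order statement, $h$ is small enough and the solution is the locally unique one with $Y_i\to y_0$ as $h\to0$. *)

theory Defs
  imports
    "HOL-Analysis.Analysis"
    "HOL-Computational_Algebra.Polynomial"
    "HOL-Library.Landau_Symbols"
begin

section \<open>Linear algebra and gradients\<close>

definition kronecker ::
    "real^'a^'b \<Rightarrow> real^'c^'d \<Rightarrow> real^('a \<times> 'c)^('b \<times> 'd)" (infixr "\<otimes>\<^sub>K" 75) where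
  "A \<otimes>\<^sub>K B = (\<chi> i j. A $ fst i $ fst j * B $ snd i $ snd j)"

definition J2 :: "real^2^2" where
  "J2 = vector [vector [0, 1], vector [- 1, 0]]"

definition absJ2 :: "real^2^2" where
  "absJ2 = vector [vector [0, 1], vector [1, 0]]"

definition gradient :: "('a::real_inner \<Rightarrow> real) \<Rightarrow> 'a \<Rightarrow> 'a" where
  "gradient F y = (THE g. GDERIV F y :> g)"


section \<open>The Hamiltonian problem\<close>

text \<open>
  The integer \<open>N\<close> is \<open>CARD('n)\<close>, where \<open>'n\<close> is an arbitrary finite linearly ordered type; its
  elements stand, in increasing order, for the frequencies \<open>1, \<dots>, N\<close>.  A vector of dimension
  \<open>2N\<close> is indexed by \<open>'n \<times> 2\<close>: the components \<open>(j, 1)\<close> and \<open>(j, 2)\<close> are those numbered \<open>2j - 1\<close>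
  and \<open>2j\<close>, so that the index pairs match the Kronecker product above.
  Likewise \<open>y = (q, p)\<close> is indexed by \<open>2 \<times> ('n \<times> 2)\<close>.
\<close>

definition freq :: "'n::{finite,linorder} \<Rightarrow> nat" where
  "freq j = card {..j}"

definition cos_basis :: "real \<Rightarrow> real \<Rightarrow> nat \<Rightarrow> real \<Rightarrow> real" where
  "cos_basis a b j x = sqrt (2 / (b - a)) * cos (2 * pi * real j * ((x - a) / (b - a)))"

definition sin_basis :: "real \<Rightarrow> real \<Rightarrow> nat \<Rightarrow> real \<Rightarrow> real" where
  "sin_basis a b j x = sqrt (2 / (b - a)) * sin (2 * pi * real j * ((x - a) / (b - a)))"

definition omega :: "real \<Rightarrow> real \<Rightarrow> real \<Rightarrow> real^('n::{finite,linorder} \<times> 2)" where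
  "omega a b x =
     (\<chi> i. if snd i = 1 then sin_basis a b (freq (fst i)) x else cos_basis a b (freq (fst i)) x)"

definition Dmat :: "real \<Rightarrow> real \<Rightarrow> real^'n::{finite,linorder}^'n::{finite,linorder}" where
  "Dmat a b = (\<chi> i j. if i = j then 2 * pi / (b - a) * real (freq i) else 0)"

definition q_part :: "real^(2 \<times> 'm::finite) \<Rightarrow> real^'m" where
  "q_part y = (\<chi> i. y $ (1, i))"

definition p_part :: "real^(2 \<times> 'm::finite) \<Rightarrow> real^'m" where
  "p_part y = (\<chi> i. y $ (2, i))"

definition join_qp :: "real^'m::finite \<Rightarrow> real^'m \<Rightarrow> real^(2 \<times> 'm)" where
  "join_qp q p = (\<chi> i. if fst i = 1 then q $ snd i else p $ snd i)"

definition hamiltonian ::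
    "real \<Rightarrow> real \<Rightarrow> real \<Rightarrow> real^(2 \<times> 'n::{finite,linorder} \<times> 2) \<Rightarrow> real" where
  "hamiltonian a b u0 y =
     (let q = q_part y; p = p_part y; D = Dmat a b
      in 1 / 2 * (p \<bullet> p + q \<bullet> (((D ** D) \<otimes>\<^sub>K mat 1) *v q)
           + 2 / 3 * integral {a..b} (\<lambda>x. (u0 + omega a b x \<bullet> q) ^ 3)))"

definition ham_field ::
    "real \<Rightarrow> real \<Rightarrow> real \<Rightarrow> real^(2 \<times> 'n::{finite,linorder} \<times> 2) \<Rightarrow> real^(2 \<times> 'n::{finite,linorder} \<times> 2)" where
  "ham_field a b u0 y =
     (absJ2 \<otimes>\<^sub>K Dmat a b \<otimes>\<^sub>K transpose J2) *v gradient (hamiltonian a b u0) y"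

definition ham_field_explicit ::
    "real \<Rightarrow> real \<Rightarrow> real \<Rightarrow> real^(2 \<times> 'n::{finite,linorder} \<times> 2) \<Rightarrow> real^(2 \<times> 'n::{finite,linorder} \<times> 2)" where
  "ham_field_explicit a b u0 y =
     (let q = q_part y; p = p_part y; D = Dmat a b
      in join_qp
           ((D \<otimes>\<^sub>K transpose J2) *v p)
           ((D \<otimes>\<^sub>K transpose J2) *v
              (((D ** D) \<otimes>\<^sub>K mat 1) *v q
               + integral {a..b} (\<lambda>x. (u0 + omega a b x \<bullet> q)\<^sup>2 *\<^sub>R omega a b x))))"


section \<open>Runge-Kutta methods\<close>

text \<open>Stages are numbered from \<open>0\<close> to \<open>k - 1\<close>; values at other indices are irrelevant.\<close>

definition rk_stages ::
    "nat \<Rightarrow> (nat \<Rightarrow> nat \<Rightarrow> real) \<Rightarrow> ('a::real_normed_vector \<Rightarrow> 'a) \<Rightarrow> real \<Rightarrow> 'a \<Rightarrow> (nat \<Rightarrow> 'a) \<Rightarrow> bool"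
  where
  "rk_stages k A f h y0 Y \<longleftrightarrow> (\<forall>i<k. Y i = y0 + h *\<^sub>R (\<Sum>j<k. A i j *\<^sub>R f (Y j)))"

definition rk_update ::
    "nat \<Rightarrow> (nat \<Rightarrow> real) \<Rightarrow> ('a::real_normed_vector \<Rightarrow> 'a) \<Rightarrow> real \<Rightarrow> 'a \<Rightarrow> (nat \<Rightarrow> 'a) \<Rightarrow> 'a" where
  "rk_update k b f h y0 Y = y0 + h *\<^sub>R (\<Sum>i<k. b i *\<^sub>R f (Y i))"

definition rk_conserves ::
    "nat \<Rightarrow> (nat \<Rightarrow> nat \<Rightarrow> real) \<Rightarrow> (nat \<Rightarrow> real) \<Rightarrow> ('a::real_normed_vector \<Rightarrow> 'a) \<Rightarrow> ('a \<Rightarrow> real) \<Rightarrow> bool"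
  where
  "rk_conserves k A b f H \<longleftrightarrow>
     (\<forall>h y0 Y. rk_stages k A f h y0 Y \<longrightarrow> H (rk_update k b f h y0 Y) = H y0)"

text \<open>\<open>Y\<close> is the locally unique family of stage vectors tending to \<open>y0\<close> as the stepsize tends to \<open>0\<close>.\<close>

definition rk_stage_branch ::
    "nat \<Rightarrow> (nat \<Rightarrow> nat \<Rightarrow> real) \<Rightarrow> ('a::real_normed_vector \<Rightarrow> 'a) \<Rightarrow> 'a \<Rightarrow> (real \<Rightarrow> nat \<Rightarrow> 'a) \<Rightarrow> bool"
  where
  "rk_stage_branch k A f y0 Y \<longleftrightarrow>
     (\<forall>i<k. ((\<lambda>h. Y h i) \<longlongrightarrow> y0) (at 0)) \<and>
     (\<exists>h0>0. \<exists>r>0. \<forall>h. \<bar>h\<bar> < h0 \<longrightarrow>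
        rk_stages k A f h y0 (Y h) \<and>
        (\<forall>Z. rk_stages k A f h y0 Z \<and> (\<forall>i<k. Z i \<in> ball y0 r) \<longrightarrow> (\<forall>i<k. Z i = Y h i)))"

definition ivp_solution ::
    "('a::real_normed_vector \<Rightarrow> 'a) \<Rightarrow> 'a \<Rightarrow> real set \<Rightarrow> (real \<Rightarrow> 'a) \<Rightarrow> bool" where
  "ivp_solution f y0 I y \<longleftrightarrow>
     is_interval I \<and> 0 \<in> I \<and> y 0 = y0 \<and>
     (\<forall>t\<in>I. (y has_vector_derivative f (y t)) (at t within I))"

text \<open>
  Order (at least) \<open>p\<close> for the vector field \<open>f\<close>.  The interval \<open>I\<close> of existence of the exact
  solution may be one- or two-sided, so stepsizes of either sign are covered.
\<close>

definition rk_has_order ::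
    "nat \<Rightarrow> (nat \<Rightarrow> nat \<Rightarrow> real) \<Rightarrow> (nat \<Rightarrow> real) \<Rightarrow> ('a::real_normed_vector \<Rightarrow> 'a) \<Rightarrow> nat \<Rightarrow> bool" where
  "rk_has_order k A b f p \<longleftrightarrow>
     (\<forall>y0. \<exists>Y. rk_stage_branch k A f y0 Y \<and>
        (\<forall>I y. ivp_solution f y0 I y \<longrightarrow>
           (\<lambda>h. norm (rk_update k b f h y0 (Y h) - y h)) \<in> O[at 0 within I](\<lambda>h. h ^ (p + 1))))"


section \<open>Hamiltonian Boundary Value Methods\<close>

text \<open>Rodrigues' formula on \<open>[-1, 1]\<close>.\<close>

definition legendre_poly :: "nat \<Rightarrow> real poly" where
  "legendre_poly n = smult (1 / (2 ^ n * fact n)) ((pderiv ^^ n) ([:-1, 0, 1:] ^ n))"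

text \<open>
  On \<open>[-1, 1]\<close> the squared norm of the Legendre polynomial of degree \<open>n\<close> is \<open>2 / (2n + 1)\<close>, hence
  the polynomials below are orthonormal on \<open>[0, 1]\<close>.
\<close>

definition legendre01 :: "nat \<Rightarrow> real poly" where
  "legendre01 n = smult (sqrt (2 * real n + 1)) (pcompose (legendre_poly n) [:-1, 2:])"

text \<open>
  The \<open>k\<close>-point Gauss-Legendre formula on \<open>[0, 1]\<close>: the nodes are the zeros of \<open>legendre01 k\<close> in
  increasing order, the weights are the integrals of the Lagrange basis polynomials at the nodes.
\<close>

definition gl_node :: "nat \<Rightarrow> nat \<Rightarrow> real" where
  "gl_node k i = sorted_list_of_set {x. poly (legendre01 k) x = 0} ! i"

definition gl_weight :: "nat \<Rightarrow> nat \<Rightarrow> real" where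
  "gl_weight k i =
     integral {0..1} (\<lambda>x. \<Prod>j\<in>{..<k} - {i}. (x - gl_node k j) / (gl_node k i - gl_node k j))"

text \<open>The entries of \<open>\<I>\<^sub>s \<P>\<^sub>s\<^sup>T \<Omega>\<close>.\<close>

definition hbvm_A :: "nat \<Rightarrow> nat \<Rightarrow> nat \<Rightarrow> nat \<Rightarrow> real" where
  "hbvm_A k s i j =
     (\<Sum>m<s. integral {0..gl_node k i} (\<lambda>x. poly (legendre01 m) x)
        * poly (legendre01 m) (gl_node k j)) * gl_weight k j"

definition hbvm_b :: "nat \<Rightarrow> nat \<Rightarrow> real" where
  "hbvm_b k = gl_weight k"

end

theory Submission
  imports Defs
begin

text \<open>
  The Hamiltonian is a polynomial of degree three in \<open>y\<close>, so its gradient \<open>G\<close> is a polynomial map of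
  degree two, and the vector field is \<open>f = S \<circ> G\<close> with the skew-symmetric matrix
  \<open>S = |J\<^sub>2| \<otimes> D \<otimes> J\<^sub>2\<^sup>T\<close>.

  The stages of HBVM(\<open>k\<close>,\<open>s\<close>) are the values at the Gauss nodes of a polynomial path \<open>\<sigma>\<close> of degree at most
  \<open>s\<close> that runs from \<open>y\<^sub>0\<close> at \<open>0\<close> to \<open>y\<^sub>1\<close> at \<open>1\<close>.  Its derivative is \<open>h\<close> times
  \<open>\<gamma>\<^sub>0 P\<^sub>0 + \<dots> + \<gamma>\<^sub>s\<^sub>-\<^sub>1 P\<^sub>s\<^sub>-\<^sub>1\<close>, where \<open>\<gamma>\<^sub>m\<close> is the \<open>k\<close>-point quadrature value of the \<open>m\<close>-th Legendre
  coefficient of \<open>f \<circ> \<sigma>\<close>.  Since \<open>f \<circ> \<sigma>\<close> has degree at most \<open>2s\<close>, the products with polynomials of degree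
  below \<open>s\<close> have degree at most \<open>3s - 1 \<le> 2k - 1\<close>, which is exactly the range in which the quadrature
  makes no error.  Both assertions rest on this.

  Energy (\<open>hbvm_conserves_cubic\<close>): \<open>H(y\<^sub>1) - H(y\<^sub>0)\<close> is the integral of \<open>G(\<sigma>) \<bullet> \<sigma>'\<close>, a polynomial of degree
  at most \<open>3s - 1\<close>.  Replacing the integral by the quadrature turns it into
  \<open>h\<close> times the sum of the \<open>g\<^sub>m \<bullet> S g\<^sub>m\<close>, where \<open>g\<^sub>m\<close> are the discrete Legendre coefficients of \<open>G \<circ> \<sigma>\<close>, and
  every term vanishes because \<open>S\<close> is skew-symmetric.

  Order (\<open>hbvm_order_quadratic\<close>): let \<open>E(c) = \<sigma>(c) - y(hc)\<close>.  The discrete Legendre projection reproduces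
  polynomials of degree below \<open>s\<close>, and \<open>y'\<close> agrees with such a polynomial up to \<open>O(h\<^sup>s)\<close>; a contraction
  argument then gives \<open>E = O(h\<^sup>s\<^sup>+\<^sup>1)\<close> on the whole step (\<open>hbvm_path_error\<close>).  At the end point more is true.
  The defect \<open>\<sigma>'/h - f(\<sigma>)\<close> is orthogonal to all polynomials of degree below \<open>s\<close>, so it disappears from the
  equations that relate the moments \<open>\<integral> c\<^sup>i E(c) dc\<close> to each other and to \<open>E(1)\<close>.  A descending induction
  over these moments bounds \<open>E(1)\<close> by a multiple of \<open>h |E(1)| + h\<^sup>2\<^sup>s\<^sup>+\<^sup>1\<close>
  (\<open>moment_bootstrap\<close>, \<open>hbvm_path_endpoint_error\<close>), and the first term is absorbed for small \<open>h\<close>.  The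
  moments take over the role that the solution of the adjoint variational equation has in the usual
  proof by nonlinear variation of constants.
\<close>

section \<open>Shifted Legendre polynomials\<close>

definition unit_integral :: "real poly \<Rightarrow> real" where
  "unit_integral p = integral {0..1} (poly p)"

lemma poly_integrable_on: "poly (p :: real poly) integrable_on {a..b}"
  by (intro integrable_continuous_real continuous_intros)

lemma unit_integral_0 [simp]: "unit_integral 0 = 0"
  by (simp add: unit_integral_def poly_0[abs_def])

lemma unit_integral_add: "unit_integral (p + q) = unit_integral p + unit_integral q"
  by (simp add: unit_integral_def poly_add[abs_def] integral_add poly_integrable_on)

lemma unit_integral_smult: "unit_integral (smult c p) = c * unit_integral p"
  by (simp add: unit_integral_def poly_smult[abs_def])

lemma unit_integral_diff: "unit_integral (p - q) = unit_integral p - unit_integral q"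
  by (simp add: unit_integral_def poly_diff[abs_def] integral_diff poly_integrable_on)

lemma unit_integral_sum: "unit_integral (\<Sum>i\<in>A. p i) = (\<Sum>i\<in>A. unit_integral (p i))"
  by (induction A rule: infinite_finite_induct) (simp_all add: unit_integral_add)

lemma unit_integral_pderiv: "unit_integral (pderiv p) = poly p 1 - poly p 0"
proof -
  have "(poly (pderiv p) has_integral (poly p 1 - poly p 0)) {0..1}"
    by (intro fundamental_theorem_of_calculus)
       (auto simp flip: has_real_derivative_iff_has_vector_derivative
             intro: DERIV_subset poly_DERIV)
  then show ?thesis by (simp add: unit_integral_def integral_unique)
qed

lemma unit_integral_by_parts:
  "unit_integral (pderiv p * q) = poly (p * q) 1 - poly (p * q) 0 - unit_integral (p * pderiv q)"
  using unit_integral_pderiv[of "p * q"]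
  by (simp add: pderiv_mult unit_integral_add algebra_simps)

text \<open>
  Each differentiation lowers the multiplicity of a factor by at most one.  Applied to \<open>x\<^sup>2 - x\<close>, this makes
  the boundary terms vanish in the repeated integration by parts below, and it supplies two further zeros
  for Rolle's theorem.
\<close>

lemma higher_pderiv_power_dvd:
  fixes u :: "real poly"
  shows "j \<le> n \<Longrightarrow> u ^ (n - j) dvd (pderiv ^^ j) (u ^ n)"
proof (induction j)
  case (Suc j)
  then obtain r where r: "(pderiv ^^ j) (u ^ n) = u ^ (n - j) * r" by auto
  obtain m where m: "n - j = Suc m" "n - Suc j = m" using Suc.prems by (metis Suc_diff_Suc Suc_le_lessD)
  have "(pderiv ^^ Suc j) (u ^ n) = u ^ m * (u * pderiv r + smult (of_nat (Suc m)) (r * pderiv u))"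
    by (simp add: r m pderiv_mult pderiv_power_Suc algebra_simps del: of_nat_Suc power_Suc)
       (simp add: algebra_simps)
  then show ?case using m by simp
qed simp

definition rodrigues :: "nat \<Rightarrow> real poly" where
  "rodrigues n = [:0, -1, 1:] ^ n"

lemma pcompose_power: "pcompose (p ^ n) q = pcompose p q ^ n"
  for p q :: "real poly"
  by (induction n) (simp_all add: pcompose_1 pcompose_mult)

lemma higher_pderiv_pcompose_linear:
  "(pderiv ^^ n) (pcompose p [:a, b:]) = smult (b ^ n) (pcompose ((pderiv ^^ n) p) [:a, b :: real:])"
  by (induction n)
     (simp_all add: pderiv_pcompose pderiv_smult pderiv_pCons mult.commute[of b])

text \<open>
  Rodrigues' formula carried over to \<open>[0, 1]\<close>: the substitution \<open>x \<mapsto> 2x - 1\<close> turns \<open>x\<^sup>2 - 1\<close> into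
  \<open>4(x\<^sup>2 - x)\<close> and multiplies each derivative by \<open>2\<close>.
\<close>

lemma legendre01_rodrigues:
  "legendre01 n = smult (sqrt (2 * real n + 1) / fact n) ((pderiv ^^ n) (rodrigues n))"
proof -
  have "pcompose ([:-1, 0, 1:] ^ n) [:-1, 2:] = smult (4 ^ n) (rodrigues n)"
  proof -
    have "pcompose [:-1, 0, 1:] [:-1, 2:] = smult 4 [:0, -1, 1 :: real:]"
      by (simp add: pcompose_pCons)
    then show ?thesis by (simp add: pcompose_power smult_power rodrigues_def del: smult_pCons)
  qed
  then have "smult (4 ^ n) ((pderiv ^^ n) (rodrigues n)) =
      smult (2 ^ n) (pcompose ((pderiv ^^ n) ([:-1, 0, 1:] ^ n)) [:-1, 2 :: real:])"
    by (metis higher_pderiv_pcompose_linear higher_pderiv_smult)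
  then have "smult (1 / 2 ^ n) (smult (4 ^ n) ((pderiv ^^ n) (rodrigues n))) =
      pcompose ((pderiv ^^ n) ([:-1, 0, 1:] ^ n)) [:-1, 2 :: real:]"
    by simp
  moreover have "(4::real) ^ n = 2 ^ n * 2 ^ n" by (simp flip: power_mult_distrib)
  ultimately have eq: "pcompose ((pderiv ^^ n) ([:-1, 0, 1:] ^ n)) [:-1, 2 :: real:] =
      smult (2 ^ n) ((pderiv ^^ n) (rodrigues n))" by simp
  show ?thesis
    unfolding legendre01_def legendre_poly_def pcompose_smult eq by simp
qed

lemma degree_rodrigues: "degree (rodrigues n) = 2 * n"
  by (simp add: rodrigues_def degree_power_eq)

lemma lead_coeff_rodrigues: "coeff (rodrigues n) (2 * n) = 1"
proof -
  have "lead_coeff (rodrigues n) = 1" by (simp add: rodrigues_def lead_coeff_power)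
  then show ?thesis by (simp add: degree_rodrigues)
qed

lemma degree_legendre01: "degree (legendre01 n) = n"
  by (simp add: legendre01_rodrigues degree_higher_pderiv degree_rodrigues add_nonneg_eq_0_iff)

lemma legendre01_nonzero: "legendre01 n \<noteq> 0"
proof (cases n)
  case 0
  then show ?thesis by (simp add: legendre01_rodrigues rodrigues_def)
qed (use degree_legendre01[of n] in auto)

lemma legendre01_0: "legendre01 0 = 1"
  by (simp add: legendre01_rodrigues rodrigues_def)

text \<open>
  Moving all derivatives onto the other factor: the boundary terms vanish because the intermediate
  derivatives of the power still contain the factor that vanishes at both endpoints.
\<close>

lemma unit_integral_rodrigues_shift:
  assumes "j \<le> n"
  shows "unit_integral ((pderiv ^^ j) (rodrigues n) * q) =
    (-1) ^ j * unit_integral (rodrigues n * (pderiv ^^ j) q)"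
  using assms
proof (induction j arbitrary: q)
  case (Suc j)
  have "[:0, -1, 1:] dvd (pderiv ^^ j) (rodrigues n)"
    using dvd_trans[OF dvd_power higher_pderiv_power_dvd[of j n "[:0, -1, 1:]"]] Suc.prems
    by (simp add: rodrigues_def)
  then have "poly ((pderiv ^^ j) (rodrigues n)) 1 = 0" "poly ((pderiv ^^ j) (rodrigues n)) 0 = 0"
    by (auto elim!: dvdE)
  then have "unit_integral ((pderiv ^^ Suc j) (rodrigues n) * q) =
      - unit_integral ((pderiv ^^ j) (rodrigues n) * pderiv q)"
    by (simp add: unit_integral_by_parts)
  also have "\<dots> = (-1) ^ Suc j * unit_integral (rodrigues n * (pderiv ^^ Suc j) q)"
    using Suc by (simp add: funpow_swap1)
  finally show ?case .
qed simp

lemma legendre01_orthogonal: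
  assumes "degree q < n"
  shows "unit_integral (legendre01 n * q) = 0"
proof -
  have "degree ((pderiv ^^ n) q) = 0" using assms by (simp add: degree_higher_pderiv)
  moreover have "coeff ((pderiv ^^ n) q) 0 = 0"
    using assms by (simp add: coeff_higher_pderiv coeff_eq_0)
  ultimately have "(pderiv ^^ n) q = 0" by (metis degree_0_id of_nat_0 pCons_0_0)
  then show ?thesis
    by (simp add: legendre01_rodrigues unit_integral_smult unit_integral_rodrigues_shift)
qed

text \<open>
  The Beta integral at integer arguments; it gives the norm of the Legendre polynomials.
\<close>

lemma unit_integral_beta:
  "unit_integral ([:0, 1:] ^ m * [:1, -1:] ^ n) = fact m * fact n / fact (m + n + 1)"
proof (induction n arbitrary: m)
  case 0
  have "unit_integral (pderiv ([:0, 1:] ^ Suc m)) = 1"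
    unfolding unit_integral_pderiv by simp
  then have "(1 + real m) * unit_integral ([:0, 1:] ^ m) = 1"
    by (simp add: pderiv_power_Suc pderiv_pCons unit_integral_smult del: power_Suc)
  then have "unit_integral ([:0, 1:] ^ m) = 1 / (1 + real m)"
    by (subst eq_divide_eq) (simp add: mult.commute)
  then show ?case by simp
next
  case (Suc n)
  have x: "pderiv ([:0, 1:] ^ Suc m) = smult (1 + real m) ([:0, 1:] ^ m)"
    and y: "pderiv ([:1, -1:] ^ Suc n) = smult (- (1 + real n)) ([:1, -1:] ^ n)"
    by (simp_all add: pderiv_power_Suc pderiv_pCons del: power_Suc)
  have "unit_integral (pderiv ([:0, 1:] ^ Suc m) * [:1, -1:] ^ Suc n) =
      (1 + real n) * unit_integral ([:0, 1:] ^ Suc m * [:1, -1:] ^ n)"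
    unfolding unit_integral_by_parts y mult_smult_right unit_integral_smult
    by (simp add: algebra_simps)
  then have "(1 + real m) * unit_integral ([:0, 1:] ^ m * [:1, -1:] ^ Suc n) =
      (1 + real n) * (fact (Suc m) * fact n / fact (Suc m + n + 1))"
    unfolding Suc x mult_smult_left unit_integral_smult .
  then have "unit_integral ([:0, 1:] ^ m * [:1, -1:] ^ Suc n) =
      (1 + real n) * (fact (Suc m) * fact n / fact (Suc m + n + 1)) / (1 + real m)"
    by (subst eq_divide_eq) (simp add: mult.commute)
  also have "\<dots> = (1 + real n) * (((1 + real m) * fact m) * fact n / fact (m + Suc n + 1)) / (1 + real m)"
    by simp
  also have "\<dots> = fact m * fact (Suc n) / fact (m + Suc n + 1)"
  proof -
    have cancel: "y * ((x * u) * v / w) / x = u * (y * v) / w" if "x \<noteq> 0" for x y u v w :: real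
      using that by simp
    have fact_Suc_n: "fact (Suc n) = (1 + real n) * fact n" by simp
    show ?thesis unfolding fact_Suc_n by (rule cancel) simp
  qed
  finally show ?case .
qed

text \<open>
  Moving all \<open>n\<close> derivatives of one factor onto the other leaves \<open>x\<^sup>2 - x\<close> to the power \<open>n\<close> times the constant
  \<open>(2n)!\<close>, and hence a Beta integral.
\<close>

lemma legendre01_norm: "unit_integral (legendre01 n * legendre01 n) = 1"
proof -
  define R where "R = (pderiv ^^ n) (rodrigues n)"
  have "(pderiv ^^ n) R = [:fact (2 * n):]"
  proof -
    have "(pderiv ^^ n) R = (pderiv ^^ (2 * n)) (rodrigues n)"
      by (simp add: R_def mult_2 funpow_add)
    moreover have "degree ((pderiv ^^ (2 * n)) (rodrigues n)) = 0"
      by (simp add: degree_higher_pderiv degree_rodrigues)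
    moreover have "coeff ((pderiv ^^ (2 * n)) (rodrigues n)) 0 = fact (2 * n)"
      by (simp add: coeff_higher_pderiv lead_coeff_rodrigues pochhammer_fact)
    ultimately show ?thesis by (metis degree_0_id)
  qed
  then have "unit_integral (R * R) = (-1) ^ n * fact (2 * n) * unit_integral (rodrigues n)"
    using unit_integral_rodrigues_shift[of n n R]
    by (simp add: unit_integral_smult R_def[symmetric])
  also have "rodrigues n = smult ((-1) ^ n) ([:0, 1:] ^ n * [:1, -1:] ^ n)"
  proof -
    have "[:0, -1, 1:] = smult (-1) ([:0, 1:] * [:1, -1 :: real:])" by simp
    then show ?thesis
      by (simp only: rodrigues_def smult_power power_mult_distrib)
  qed
  also have "unit_integral \<dots> = (-1) ^ n * (fact n * fact n / fact (2 * n + 1))"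
    by (simp only: unit_integral_smult unit_integral_beta mult_2)
  also have "fact (2 * n + 1) = (2 * real n + 1) * fact (2 * n)" by simp
  finally have "unit_integral (R * R) = ((-1) ^ n * (-1) ^ n) * (fact n * fact n) / (2 * real n + 1)"
    by simp
  also have "(-1) ^ n * (-1) ^ n = (1 :: real)" by (simp flip: power_mult_distrib)
  finally have "unit_integral (R * R) = fact n * fact n / (2 * real n + 1)" by simp
  then show ?thesis
    unfolding legendre01_rodrigues R_def[symmetric]
    by (simp add: unit_integral_smult field_simps)
qed

lemma legendre01_orthonormal:
  "unit_integral (legendre01 m * legendre01 n) = (if m = n then 1 else 0)"
  using legendre01_orthogonal[of "legendre01 m" n] legendre01_orthogonal[of "legendre01 n" m]
    legendre01_norm[of m]
  by (cases m n rule: linorder_cases) (auto simp: degree_legendre01 mult.commute)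

lemma unit_integral_legendre01: "unit_integral (legendre01 m) = (if m = 0 then 1 else 0)"
  using legendre01_orthonormal[of m 0] by (simp add: legendre01_0)

text \<open>
  Orthogonality to the polynomial of the highest degree in question removes the leading coefficient.
  The hypothesis on the degree is stated with coefficients so that \<open>s = 0\<close> is a meaningful start of the
  induction.
\<close>

lemma orthogonal_to_legendre01_eq_0:
  assumes "\<And>i. s \<le> i \<Longrightarrow> coeff p i = 0" "\<And>m. m < s \<Longrightarrow> unit_integral (legendre01 m * p) = 0"
  shows "p = 0"
  using assms
proof (induction s arbitrary: p)
  case 0
  then show ?case by (simp add: poly_eq_iff)
next
  case (Suc s)
  define c where "c = coeff p s / lead_coeff (legendre01 s)"
  have lc: "coeff (legendre01 s) s \<noteq> 0"
    using legendre01_nonzero[of s] degree_legendre01[of s] by (metis leading_coeff_0_iff)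
  define r where "r = p - smult c (legendre01 s)"
  have "coeff r i = 0" if "s \<le> i" for i
  proof (cases "i = s")
    case True
    then show ?thesis using lc by (simp add: r_def c_def degree_legendre01)
  next
    case False
    then show ?thesis using that Suc.prems(1)[of i]
      by (simp add: r_def coeff_eq_0 degree_legendre01)
  qed
  then have r: "r = 0 \<or> degree r < s"
    by (metis leading_coeff_0_iff linorder_not_le)
  have "unit_integral (legendre01 s * r) = 0"
    using r legendre01_orthogonal by auto
  then have "c = 0"
    using Suc.prems(2)[of s]
    by (simp add: r_def right_diff_distrib unit_integral_diff unit_integral_smult legendre01_norm)
  then have "r = p" by (simp add: r_def)
  then show ?case using Suc.IH[of p] Suc.prems \<open>\<And>i. s \<le> i \<Longrightarrow> coeff r i = 0\<close> by simp
qed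

lemma legendre01_expansion:
  assumes "degree q < s"
  shows "(\<Sum>m<s. smult (unit_integral (legendre01 m * q)) (legendre01 m)) = q"
proof -
  define r where "r = q - (\<Sum>m<s. smult (unit_integral (legendre01 m * q)) (legendre01 m))"
  have "r = 0"
  proof (rule orthogonal_to_legendre01_eq_0)
    fix i assume "s \<le> i"
    then show "coeff r i = 0"
      using assms by (auto simp: r_def coeff_sum coeff_eq_0 degree_legendre01 intro!: sum.neutral)
  next
    fix m assume "m < s"
    then show "unit_integral (legendre01 m * r) = 0"
      by (simp add: r_def right_diff_distrib sum_distrib_left unit_integral_diff unit_integral_sum
          unit_integral_smult legendre01_orthonormal sum.delta if_distrib cong: if_cong)
  qed
  then show ?thesis by (simp add: r_def)
qed

section \<open>Gauss-Legendre quadrature\<close>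

text \<open>
  Between consecutive zeros of \<open>f\<close> there is a zero of its derivative; the induction removes the largest zero.
\<close>

lemma rolle_zeros:
  fixes f f' :: "real \<Rightarrow> real"
  assumes "\<And>x. (f has_real_derivative f' x) (at x)"
    and "finite S" "S \<subseteq> {a..b}" "card S = Suc m" "\<And>x. x \<in> S \<Longrightarrow> f x = 0"
  shows "\<exists>T. finite T \<and> card T = m \<and> T \<subseteq> {a<..<b} \<and> (\<forall>x\<in>T. f' x = 0)"
  using assms(2-)
proof (induction m arbitrary: S b)
  case 0
  then show ?case by (intro exI[of _ "{}"]) auto
next
  case (Suc m)
  define M where "M = Max S"
  have M: "M \<in> S" "\<And>x. x \<in> S \<Longrightarrow> x \<le> M"
    using Suc.prems by (auto simp: M_def intro!: Max_in)
  define S' where "S' = S - {M}"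
  have cS': "card S' = Suc m" and fS': "finite S'" using Suc.prems M by (auto simp: S'_def)
  define L where "L = Max S'"
  have "S' \<noteq> {}" using cS' by auto
  then have L: "L \<in> S'" "\<And>x. x \<in> S' \<Longrightarrow> x \<le> L"
    using fS' by (auto simp: L_def intro!: Max_in)
  have "L < M" using L(1) M(2)[of L] by (auto simp: S'_def)
  obtain T where T: "finite T" "card T = m" "T \<subseteq> {a<..<L}" "\<forall>x\<in>T. f' x = 0"
  proof -
    have "S' \<subseteq> {a..b}" "\<And>x. x \<in> S' \<Longrightarrow> f x = 0"
      using Suc.prems(2,4) by (auto simp: S'_def)
    moreover from this(1) L(2) have "S' \<subseteq> {a..L}" by (meson atLeastAtMost_iff subset_iff)
    ultimately show ?thesis using Suc.IH[of S' L] cS' fS' that by blast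
  qed
  have "\<exists>z. L < z \<and> z < M \<and> (*) (f' z) = (\<lambda>v. 0)"
  proof (rule Rolle_deriv[OF \<open>L < M\<close>])
    show "f L = f M" using Suc.prems(4) L(1) M(1) by (auto simp: S'_def)
    show "continuous_on {L..M} f"
      using assms(1) by (meson DERIV_continuous continuous_at_imp_continuous_on)
    show "(f has_derivative (*) (f' x)) (at x)" for x
      using assms(1)[of x] by (simp add: has_field_derivative_def)
  qed
  then obtain z where z: "L < z" "z < M" "f' z = 0" by (auto dest!: fun_cong[where x = 1])
  have "a \<le> L" "M \<le> b" using L(1) M(1) Suc.prems(2) by (auto simp: S'_def)
  then have "insert z T \<subseteq> {a<..<b}" using T(3) z by force
  moreover have "card (insert z T) = Suc m" using T z by (subst card_insert_disjoint) auto
  ultimately show ?case using T z by (intro exI[of _ "insert z T"]) auto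
qed

text \<open>
  As long as \<open>j < n\<close>, the \<open>j\<close>-th derivative vanishes at \<open>0\<close> and \<open>1\<close> in addition to the \<open>j\<close> interior zeros
  already found, so that Rolle's theorem yields one more interior zero for the next derivative.
\<close>

lemma higher_pderiv_rodrigues_zeros:
  "j \<le> n \<Longrightarrow> \<exists>S. finite S \<and> card S = j \<and> S \<subseteq> {0<..<1} \<and>
     (\<forall>x\<in>S. poly ((pderiv ^^ j) (rodrigues n)) x = 0)"
proof (induction j)
  case 0
  then show ?case by (intro exI[of _ "{}"]) auto
next
  case (Suc j)
  then obtain S where S: "finite S" "card S = j" "S \<subseteq> {0<..<1}"
    "\<forall>x\<in>S. poly ((pderiv ^^ j) (rodrigues n)) x = 0" by auto
  have "[:0, -1, 1:] ^ (n - j) dvd (pderiv ^^ j) (rodrigues n)"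
    using higher_pderiv_power_dvd[of j n "[:0, -1, 1:]"] Suc.prems by (simp add: rodrigues_def)
  then have ends: "poly ((pderiv ^^ j) (rodrigues n)) 1 = 0" "poly ((pderiv ^^ j) (rodrigues n)) 0 = 0"
    using Suc.prems by (auto elim!: dvdE simp: poly_power)
  have "card (insert 1 S) = Suc j"
    using S by (subst card_insert_disjoint) auto
  then have card: "card (insert 0 (insert 1 S)) = Suc (Suc j)"
    using S by (subst card_insert_disjoint) auto
  have sub: "insert 0 (insert 1 S) \<subseteq> {0..1}" using S(3) by auto
  have zero: "poly ((pderiv ^^ j) (rodrigues n)) x = 0" if "x \<in> insert 0 (insert 1 S)" for x
    using that S(4) ends by auto
  show ?case
    using rolle_zeros[OF poly_DERIV _ sub card zero] S(1) by simp
qed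

lemma legendre01_roots:
  defines "Z \<equiv> \<lambda>k. {x. poly (legendre01 k) x = 0}"
  shows "finite (Z k)" "card (Z k) = k" "Z k \<subseteq> {0<..<1}"
proof -
  show fin: "finite (Z k)" unfolding Z_def by (rule poly_roots_finite[OF legendre01_nonzero])
  obtain S where S: "finite S" "card S = k" "S \<subseteq> {0<..<1}"
    "\<forall>x\<in>S. poly ((pderiv ^^ k) (rodrigues k)) x = 0"
    using higher_pderiv_rodrigues_zeros[of k k] by auto
  have sub: "S \<subseteq> Z k" using S by (auto simp: Z_def legendre01_rodrigues)
  have "card (Z k) \<le> k"
    using card_poly_roots_bound[OF legendre01_nonzero[of k]] by (simp add: Z_def degree_legendre01)
  then have "S = Z k" using sub S(2) fin by (metis card_seteq)
  then show "card (Z k) = k" "Z k \<subseteq> {0<..<1}" using S by auto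
qed

text \<open>
  The root set has exactly \<open>k\<close> elements, so the entries of its sorted enumeration with index below \<open>k\<close> are
  genuine and distinct nodes.
\<close>

lemma gl_node_root: "i < k \<Longrightarrow> poly (legendre01 k) (gl_node k i) = 0"
  and gl_node_bounds: "i < k \<Longrightarrow> 0 < gl_node k i \<and> gl_node k i < 1"
  and inj_on_gl_node: "inj_on (gl_node k) {..<k}"
proof -
  let ?Z = "{x. poly (legendre01 k) x = 0}"
  have len: "length (sorted_list_of_set ?Z) = k" and set: "set (sorted_list_of_set ?Z) = ?Z"
    using legendre01_roots[of k] by simp_all
  then have mem: "i < k \<Longrightarrow> gl_node k i \<in> ?Z" for i
    unfolding gl_node_def by (metis nth_mem)
  then show "i < k \<Longrightarrow> poly (legendre01 k) (gl_node k i) = 0" by simp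
  show "i < k \<Longrightarrow> 0 < gl_node k i \<and> gl_node k i < 1"
    using mem legendre01_roots(3)[of k] by force
  show "inj_on (gl_node k) {..<k}"
    using len nth_eq_iff_index_eq[OF distinct_sorted_list_of_set[of ?Z]]
    by (auto simp: gl_node_def inj_on_def)
qed

definition lagrange_basis :: "nat \<Rightarrow> nat \<Rightarrow> real poly" where
  "lagrange_basis k i =
     (\<Prod>j\<in>{..<k} - {i}. smult (1 / (gl_node k i - gl_node k j)) [:- gl_node k j, 1:])"

lemma gl_weight_lagrange: "gl_weight k i = unit_integral (lagrange_basis k i)"
  unfolding gl_weight_def unit_integral_def lagrange_basis_def poly_prod
  by (simp add: diff_divide_distrib)

lemma degree_lagrange_basis: "i < k \<Longrightarrow> degree (lagrange_basis k i) < k"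
proof -
  assume "i < k"
  have "degree (lagrange_basis k i) \<le> (\<Sum>j\<in>{..<k} - {i}. 1)"
    unfolding lagrange_basis_def
    by (rule order_trans[OF degree_prod_sum_le sum_mono]) auto
  then show ?thesis using \<open>i < k\<close> by simp
qed

lemma poly_lagrange_basis:
  assumes "i < k" "j < k"
  shows "poly (lagrange_basis k i) (gl_node k j) = (if i = j then 1 else 0)"
proof (cases "i = j")
  case True
  have "poly (smult (1 / (gl_node k j - gl_node k l)) [:- gl_node k l, 1:]) (gl_node k j) = 1"
    if "l \<in> {..<k} - {j}" for l
  proof -
    have "gl_node k j - gl_node k l \<noteq> 0"
      using that inj_on_gl_node[of k] assms by (auto simp: inj_on_def)
    then have "(gl_node k j - gl_node k l) / (gl_node k j - gl_node k l) = 1" by (rule divide_self)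
    then show ?thesis unfolding diff_divide_distrib by simp
  qed
  then show ?thesis unfolding True lagrange_basis_def poly_prod
    by (simp add: prod.neutral)
next
  case False
  then show ?thesis using assms unfolding lagrange_basis_def poly_prod
    by (auto intro!: prod_zero)
qed

lemma lagrange_interpolation:
  assumes "degree r < k"
  shows "(\<Sum>i<k. smult (poly r (gl_node k i)) (lagrange_basis k i)) = r"
proof (rule poly_eqI_degree[of "gl_node k ` {..<k}"])
  show "poly (\<Sum>i<k. smult (poly r (gl_node k i)) (lagrange_basis k i)) x = poly r x"
    if "x \<in> gl_node k ` {..<k}" for x
    using that by (auto simp: poly_sum poly_lagrange_basis if_distrib cong: if_cong)
  have c: "card (gl_node k ` {..<k}) = k" by (simp add: card_image inj_on_gl_node)
  then show "degree r < card (gl_node k ` {..<k})" using assms by simp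
  show "degree (\<Sum>i<k. smult (poly r (gl_node k i)) (lagrange_basis k i)) < card (gl_node k ` {..<k})"
    unfolding c using assms degree_lagrange_basis
    by (intro degree_sum_less) (auto intro: le_less_trans[OF degree_smult_le])
qed

text \<open>
  Division by the Legendre polynomial splits off a multiple of it by a quotient of degree below \<open>k\<close>.  That
  multiple integrates to zero by orthogonality and vanishes at all nodes; for the remainder the formula is
  the integral of its Lagrange interpolant.
\<close>

theorem gauss_legendre_exact:
  assumes "degree p < 2 * k"
  shows "(\<Sum>i<k. gl_weight k i * poly p (gl_node k i)) = unit_integral p"
proof -
  define q r where "q = p div legendre01 k" and "r = p mod legendre01 k"
  have p: "p = legendre01 k * q + r" by (simp add: q_def r_def)
  have "k > 0" using assms by simp
  then have r: "degree r < k"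
    using degree_mod_less'[of "legendre01 k" p] degree_mod_less[of "legendre01 k" p]
    by (auto simp: r_def legendre01_nonzero degree_legendre01)
  have q: "degree q < k"
  proof (cases "q = 0")
    case False
    have "degree (legendre01 k * q) = k + degree q"
      using False by (simp add: degree_mult_eq legendre01_nonzero degree_legendre01)
    moreover have "degree (legendre01 k * q) < 2 * k"
      using degree_diff_less[OF assms, of r] r p by (simp add: algebra_simps)
    ultimately show ?thesis by simp
  qed (use \<open>k > 0\<close> in simp)
  have "unit_integral p = unit_integral r"
    unfolding p unit_integral_add legendre01_orthogonal[OF q] by simp
  also have "\<dots> = (\<Sum>i<k. gl_weight k i * poly r (gl_node k i))"
    by (subst lagrange_interpolation[OF r, symmetric])
       (simp add: unit_integral_sum unit_integral_smult gl_weight_lagrange mult.commute)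
  also have "\<dots> = (\<Sum>i<k. gl_weight k i * poly p (gl_node k i))"
    unfolding p by (intro sum.cong) (auto simp: gl_node_root)
  finally show ?thesis by simp
qed

section \<open>Vector-valued polynomials and quadratic maps\<close>

text \<open>
  The number \<open>d\<close> is an upper bound for the degree.  The predicate is about functions, because paths are
  evaluated at the nodes, composed with the vector field and integrated.
\<close>

definition vector_poly :: "nat \<Rightarrow> (real \<Rightarrow> 'a::real_vector) \<Rightarrow> bool" where
  "vector_poly d g \<longleftrightarrow> (\<exists>v. \<forall>t. g t = (\<Sum>i\<le>d. t ^ i *\<^sub>R v i))"

lemma vector_poly_monomial: "n \<le> d \<Longrightarrow> vector_poly d (\<lambda>t. t ^ n *\<^sub>R v)"
  unfolding vector_poly_def
  by (intro exI[of _ "\<lambda>i. if i = n then v else 0"]) (simp add: if_distrib cong: if_cong)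

lemma vector_poly_const: "vector_poly d (\<lambda>t. v)"
  using vector_poly_monomial[of 0 d v] by simp

lemma vector_poly_add:
  assumes "vector_poly d f" "vector_poly d g"
  shows "vector_poly d (\<lambda>t. f t + g t)"
proof -
  obtain v w where "\<And>t. f t = (\<Sum>i\<le>d. t ^ i *\<^sub>R v i)" "\<And>t. g t = (\<Sum>i\<le>d. t ^ i *\<^sub>R w i)"
    using assms by (auto simp: vector_poly_def)
  then show ?thesis unfolding vector_poly_def
    by (intro exI[of _ "\<lambda>i. v i + w i"]) (simp add: scaleR_right_distrib sum.distrib)
qed

lemma vector_poly_sum:
  assumes "\<And>i. i \<in> A \<Longrightarrow> vector_poly d (f i)"
  shows "vector_poly d (\<lambda>t. \<Sum>i\<in>A. f i t)"
  using assms
  by (induction A rule: infinite_finite_induct) (auto intro: vector_poly_add vector_poly_const)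

lemma vector_poly_mono: "vector_poly d g \<Longrightarrow> d \<le> e \<Longrightarrow> vector_poly e g"
proof -
  assume "vector_poly d g" "d \<le> e"
  then obtain v where "g = (\<lambda>t. \<Sum>i\<le>d. t ^ i *\<^sub>R v i)" by (auto simp: vector_poly_def)
  then show ?thesis using \<open>d \<le> e\<close> by (auto intro!: vector_poly_sum vector_poly_monomial)
qed

lemma vector_poly_linear:
  assumes "linear L" "vector_poly d g"
  shows "vector_poly d (\<lambda>t. L (g t))"
proof -
  obtain v where "\<And>t. g t = (\<Sum>i\<le>d. t ^ i *\<^sub>R v i)" using assms by (auto simp: vector_poly_def)
  then show ?thesis unfolding vector_poly_def
    using assms(1) by (intro exI[of _ "\<lambda>i. L (v i)"]) (simp add: linear_sum linear_scale)
qed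

lemma vector_poly_bilinear:
  assumes "bounded_bilinear B" "vector_poly d f" "vector_poly e g"
  shows "vector_poly (d + e) (\<lambda>t. B (f t) (g t))"
proof -
  interpret bounded_bilinear B by fact
  obtain v w where "\<And>t. f t = (\<Sum>i\<le>d. t ^ i *\<^sub>R v i)" "\<And>t. g t = (\<Sum>i\<le>e. t ^ i *\<^sub>R w i)"
    using assms by (auto simp: vector_poly_def)
  then have "(\<lambda>t. B (f t) (g t)) = (\<lambda>t. \<Sum>i\<le>d. \<Sum>j\<le>e. t ^ (i + j) *\<^sub>R B (v i) (w j))"
    by (simp add: sum_left sum_right scaleR_left scaleR_right power_add scaleR_sum_right
        sum.swap[of _ "{..d}"] mult.commute)
  then show ?thesis by (auto intro!: vector_poly_sum vector_poly_monomial)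
qed

lemma vector_poly_poly:
  assumes "degree p \<le> d"
  shows "vector_poly d (\<lambda>t. poly p t *\<^sub>R v)"
proof -
  have "(\<lambda>t. poly p t *\<^sub>R v) = (\<lambda>t. \<Sum>i\<le>degree p. t ^ i *\<^sub>R (coeff p i *\<^sub>R v))"
    by (simp add: poly_altdef scaleR_sum_left mult.commute)
  moreover have "vector_poly d (\<lambda>t. \<Sum>i\<le>degree p. t ^ i *\<^sub>R (coeff p i *\<^sub>R v))"
    using assms by (intro vector_poly_sum vector_poly_monomial) auto
  ultimately show ?thesis by simp
qed

lemma vector_poly_continuous:
  fixes g :: "real \<Rightarrow> 'a::real_normed_vector"
  assumes "vector_poly d g"
  shows "continuous_on S g"
proof -
  obtain v where "g = (\<lambda>t. \<Sum>i\<le>d. t ^ i *\<^sub>R v i)" using assms by (auto simp: vector_poly_def)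
  then show ?thesis by (auto intro!: continuous_intros)
qed

text \<open>
  Discarding the powers above \<open>n\<close> costs \<open>O(t\<^sup>n\<^sup>+\<^sup>1)\<close> near \<open>0\<close>.
\<close>

lemma vector_poly_truncate:
  fixes g :: "real \<Rightarrow> 'a::real_normed_vector"
  assumes "vector_poly d g"
  shows "\<exists>v C. \<forall>t. \<bar>t\<bar> \<le> 1 \<longrightarrow> norm (g t - (\<Sum>i\<le>n. t ^ i *\<^sub>R v i)) \<le> C * \<bar>t\<bar> ^ Suc n"
proof -
  obtain v where v: "g = (\<lambda>t. \<Sum>i\<le>d + n. t ^ i *\<^sub>R v i)"
    using vector_poly_mono[OF assms, of "d + n"] by (auto simp: vector_poly_def)
  have "norm (g t - (\<Sum>i\<le>n. t ^ i *\<^sub>R v i)) \<le> (\<Sum>i\<in>{n<..d + n}. norm (v i)) * \<bar>t\<bar> ^ Suc n"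
    if t: "\<bar>t\<bar> \<le> 1" for t
  proof -
    have "{..d + n} = {..n} \<union> {n<..d + n}" by auto
    then have "g t = (\<Sum>i\<le>n. t ^ i *\<^sub>R v i) + (\<Sum>i\<in>{n<..d + n}. t ^ i *\<^sub>R v i)"
      by (simp add: v sum.union_disjoint[of "{..n}" "{n<..d + n}"] ivl_disj_int)
    then have "norm (g t - (\<Sum>i\<le>n. t ^ i *\<^sub>R v i)) = norm (\<Sum>i\<in>{n<..d + n}. t ^ i *\<^sub>R v i)" by simp
    also have "\<dots> \<le> (\<Sum>i\<in>{n<..d + n}. norm (v i) * \<bar>t\<bar> ^ Suc n)"
    proof (rule sum_norm_le)
      fix i assume "i \<in> {n<..d + n}"
      then have "\<bar>t\<bar> ^ i \<le> \<bar>t\<bar> ^ Suc n" using t by (intro power_decreasing) auto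
      then show "norm (t ^ i *\<^sub>R v i) \<le> norm (v i) * \<bar>t\<bar> ^ Suc n"
        by (simp add: power_abs mult.commute mult_left_mono)
    qed
    finally show ?thesis by (simp add: sum_distrib_right)
  qed
  then show ?thesis by blast
qed

text \<open>
  The Gauss-Legendre formula applied to the scalar monomials.
\<close>

theorem vector_poly_quadrature:
  fixes g :: "real \<Rightarrow> 'a::banach"
  assumes "vector_poly d g" "d < 2 * k"
  shows "(g has_integral (\<Sum>i<k. gl_weight k i *\<^sub>R g (gl_node k i))) {0..1}"
proof -
  obtain v where v: "g = (\<lambda>t. \<Sum>n\<le>d. t ^ n *\<^sub>R v n)" using assms by (auto simp: vector_poly_def)
  have "((\<lambda>t. t ^ n *\<^sub>R v n) has_integral ((\<Sum>i<k. gl_weight k i * gl_node k i ^ n) *\<^sub>R v n)) {0..1}"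
    if "n \<le> d" for n
  proof (rule has_integral_scaleR_left)
    have "(poly (monom 1 n) has_integral unit_integral (monom 1 n)) {0..1}"
      unfolding unit_integral_def by (intro integrable_integral poly_integrable_on)
    moreover have "unit_integral (monom 1 n) = (\<Sum>i<k. gl_weight k i * gl_node k i ^ n)"
      using gauss_legendre_exact[of "monom 1 n" k] that assms(2) by (simp add: degree_monom_eq poly_monom)
    moreover have "poly (monom 1 n) = (\<lambda>t :: real. t ^ n)" by (simp add: poly_monom fun_eq_iff)
    ultimately show "((\<lambda>t. t ^ n) has_integral (\<Sum>i<k. gl_weight k i * gl_node k i ^ n)) {0..1}"
      by simp
  qed
  then have "(g has_integral (\<Sum>n\<le>d. (\<Sum>i<k. gl_weight k i * gl_node k i ^ n) *\<^sub>R v n)) {0..1}"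
    unfolding v by (intro has_integral_sum) auto
  also have "(\<Sum>n\<le>d. (\<Sum>i<k. gl_weight k i * gl_node k i ^ n) *\<^sub>R v n) =
      (\<Sum>i<k. gl_weight k i *\<^sub>R g (gl_node k i))"
    by (simp add: v scaleR_sum_left scaleR_sum_right sum.swap[of _ "{..<k}"])
  finally show ?thesis .
qed

text \<open>
  Boundedness of the linear and bilinear parts makes these maps Lipschitz continuous on bounded sets in every
  normed space.
\<close>

definition quadratic_map :: "('a::real_normed_vector \<Rightarrow> 'b::real_normed_vector) \<Rightarrow> bool" where
  "quadratic_map F \<longleftrightarrow>
     (\<exists>w L B. bounded_linear L \<and> bounded_bilinear B \<and> F = (\<lambda>y. w + L y + B y y))"

text \<open>
  This doubling of the degree is where the ratio of \<open>k\<close> to \<open>s\<close> in the main result comes from.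
\<close>

lemma vector_poly_quadratic_map:
  assumes "quadratic_map F" "vector_poly d g"
  shows "vector_poly (2 * d) (\<lambda>t. F (g t))"
proof -
  obtain w L B where F: "bounded_linear L" "bounded_bilinear B" "F = (\<lambda>y. w + L y + B y y)"
    using assms by (auto simp: quadratic_map_def)
  have "vector_poly (2 * d) (\<lambda>t. L (g t))"
    using vector_poly_linear[OF bounded_linear.linear[OF F(1)] assms(2)]
    by (rule vector_poly_mono) simp
  moreover have "vector_poly (2 * d) (\<lambda>t. B (g t) (g t))"
    using vector_poly_bilinear[OF F(2) assms(2) assms(2)] by (simp add: mult_2)
  ultimately show ?thesis unfolding F(3)
    by (intro vector_poly_add vector_poly_const)
qed

lemma quadratic_map_compose_linear:
  assumes "quadratic_map F" "bounded_linear S"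
  shows "quadratic_map (\<lambda>y. S (F y))"
proof -
  obtain w L B where F: "bounded_linear L" "bounded_bilinear B" "F = (\<lambda>y. w + L y + B y y)"
    using assms by (auto simp: quadratic_map_def)
  interpret S: bounded_linear S by fact
  have "bounded_linear (\<lambda>y. S (L y))" by (rule bounded_linear_compose[OF assms(2) F(1)])
  moreover have "bounded_bilinear (\<lambda>x y. S (B x y))"
  proof -
    interpret B: bounded_bilinear B by fact
    obtain K where K: "\<And>a b. norm (B a b) \<le> norm a * norm b * K" using B.bounded by auto
    obtain M where M: "\<And>x. norm (S x) \<le> norm x * M" "0 \<le> M" using S.nonneg_bounded by auto
    show ?thesis
    proof
      show "\<exists>K. \<forall>a b. norm (S (B a b)) \<le> norm a * norm b * K"
      proof (intro exI allI)
        fix a b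
        have "norm (S (B a b)) \<le> norm (B a b) * M" by (rule M)
        also have "\<dots> \<le> (norm a * norm b * K) * M" by (intro mult_right_mono K M)
        finally show "norm (S (B a b)) \<le> norm a * norm b * (K * M)" by (simp add: mult.assoc)
      qed
    qed (simp_all add: B.add_left B.add_right B.scaleR_left B.scaleR_right S.add S.scaleR)
  qed
  ultimately show ?thesis unfolding quadratic_map_def F(3)
    by (intro exI[of _ "S w"] exI[of _ "\<lambda>y. S (L y)"] exI[of _ "\<lambda>x y. S (B x y)"])
       (simp add: S.add)
qed

lemma quadratic_map_continuous:
  assumes "quadratic_map F"
  shows "continuous_on S F"
proof -
  obtain w L B where F: "bounded_linear L" "bounded_bilinear B" "F = (\<lambda>y. w + L y + B y y)"
    using assms by (auto simp: quadratic_map_def)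
  have "continuous_on S L" by (rule bounded_linear.continuous_on[OF F(1) continuous_on_id])
  moreover have "continuous_on S (\<lambda>y. B y y)"
    by (rule bounded_bilinear.continuous_on[OF F(2) continuous_on_id continuous_on_id])
  ultimately show ?thesis unfolding F(3) by (intro continuous_intros)
qed

lemma quadratic_map_lipschitz:
  assumes "quadratic_map F"
  shows "\<exists>K\<ge>0. \<forall>x\<in>cball y0 1. \<forall>y\<in>cball y0 1. norm (F x - F y) \<le> K * norm (x - y)"
proof -
  obtain w L B where F: "bounded_linear L" "bounded_bilinear B" "F = (\<lambda>y. w + L y + B y y)"
    using assms by (auto simp: quadratic_map_def)
  interpret B: bounded_bilinear B by fact
  interpret L: bounded_linear L by fact
  obtain K where K: "\<And>a b. norm (B a b) \<le> norm a * norm b * K" "0 \<le> K" using B.nonneg_bounded by auto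
  obtain M where M: "\<And>x. norm (L x) \<le> norm x * M" "0 \<le> M" using L.nonneg_bounded by auto
  define R where "R = norm y0 + 1"
  have "norm (F x - F y) \<le> (M + 2 * R * K) * norm (x - y)"
    if "x \<in> cball y0 1" "y \<in> cball y0 1" for x y
  proof -
    have R: "norm x \<le> R" "norm y \<le> R"
      using that norm_triangle_ineq2[of x y0] norm_triangle_ineq2[of y y0]
      by (auto simp: R_def dist_norm norm_minus_commute)
    have "F x - F y = L (x - y) + B (x - y) x + B y (x - y)"
      by (simp add: F(3) L.diff B.diff_left B.diff_right)
    then have "norm (F x - F y) \<le> norm (L (x - y)) + norm (B (x - y) x) + norm (B y (x - y))"
      using norm_triangle_ineq[of "L (x - y) + B (x - y) x" "B y (x - y)"]
        norm_triangle_ineq[of "L (x - y)" "B (x - y) x"] by simp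
    also have "\<dots> \<le> norm (x - y) * M + norm (x - y) * norm x * K + norm y * norm (x - y) * K"
      by (intro add_mono K M)
    also have "\<dots> \<le> norm (x - y) * M + norm (x - y) * R * K + R * norm (x - y) * K"
      using R K(2) by (intro add_mono mult_right_mono mult_left_mono) auto
    finally show ?thesis by (simp add: algebra_simps)
  qed
  moreover have "0 \<le> M + 2 * R * K" using M K by (simp add: R_def)
  ultimately show ?thesis by blast
qed

section \<open>The polynomial behind an HBVM step\<close>

definition primitive :: "real poly \<Rightarrow> real poly" where
  "primitive p = (\<Sum>i\<le>degree p. monom (coeff p i / real (Suc i)) (Suc i))"

lemma pderiv_primitive: "pderiv (primitive p) = p"
proof -
  have "pderiv (primitive p) = (\<Sum>i\<le>degree p. monom (coeff p i) i)"
    unfolding primitive_def higher_pderiv_sum[of 1, simplified] by (intro sum.cong) (auto simp: pderiv_monom simp del: of_nat_Suc)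
  then show ?thesis by (simp add: poly_as_sum_of_monoms)
qed

lemma poly_primitive_0: "poly (primitive p) 0 = 0"
  by (simp add: primitive_def poly_sum poly_monom)

lemma degree_primitive: "degree (primitive p) \<le> Suc (degree p)"
  unfolding primitive_def by (intro degree_sum_le) (auto intro: order_trans[OF degree_monom_le])

lemma integral_poly: "0 \<le> c \<Longrightarrow> integral {0..c} (poly p) = poly (primitive p) c"
proof -
  assume "0 \<le> c"
  have "(poly (pderiv (primitive p)) has_integral (poly (primitive p) c - poly (primitive p) 0)) {0..c}"
    using \<open>0 \<le> c\<close> by (intro fundamental_theorem_of_calculus)
       (auto simp flip: has_real_derivative_iff_has_vector_derivative
             intro: DERIV_subset poly_DERIV)
  then show ?thesis by (simp add: pderiv_primitive poly_primitive_0 integral_unique)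
qed

text \<open>
  The quadrature value of the \<open>m\<close>-th Legendre coefficient of a function with the value \<open>g j\<close> at the \<open>j\<close>-th node.
\<close>

definition legendre_moment :: "nat \<Rightarrow> (nat \<Rightarrow> 'a::real_vector) \<Rightarrow> nat \<Rightarrow> 'a" where
  "legendre_moment k g m = (\<Sum>j<k. (gl_weight k j * poly (legendre01 m) (gl_node k j)) *\<^sub>R g j)"

definition discrete_projection :: "nat \<Rightarrow> nat \<Rightarrow> (nat \<Rightarrow> 'a::real_vector) \<Rightarrow> real \<Rightarrow> 'a" where
  "discrete_projection k s g c = (\<Sum>m<s. poly (legendre01 m) c *\<^sub>R legendre_moment k g m)"

text \<open>
  The continuous extension of the stages: integrating the discrete Legendre expansion of \<open>f\<close> along the stages
  gives a polynomial that passes through them.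
\<close>

definition hbvm_path :: "nat \<Rightarrow> nat \<Rightarrow> ('a::real_vector \<Rightarrow> 'a) \<Rightarrow> real \<Rightarrow> 'a \<Rightarrow> (nat \<Rightarrow> 'a) \<Rightarrow> real \<Rightarrow> 'a"
  where "hbvm_path k s f h y0 Y c =
    y0 + h *\<^sub>R (\<Sum>m<s. poly (primitive (legendre01 m)) c *\<^sub>R legendre_moment k (\<lambda>j. f (Y j)) m)"

lemma hbvm_path_0: "hbvm_path k s f h y0 Y 0 = y0"
  by (simp add: hbvm_path_def poly_primitive_0)

text \<open>
  Of all integrals of \<open>P\<^sub>m\<close> over \<open>[0, 1]\<close> only the one with \<open>m = 0\<close> is nonzero, and the moment that it
  multiplies is the weighted sum in the update formula.
\<close>

lemma hbvm_path_1:
  assumes "1 \<le> s"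
  shows "hbvm_path k s f h y0 Y 1 = rk_update k (hbvm_b k) f h y0 Y"
proof -
  have "poly (primitive (legendre01 m)) 1 = (if m = 0 then 1 else 0)" for m
    using unit_integral_legendre01[of m] integral_poly[of 1] by (simp add: unit_integral_def)
  then have "(\<Sum>m<s. poly (primitive (legendre01 m)) 1 *\<^sub>R legendre_moment k (\<lambda>j. f (Y j)) m) =
      legendre_moment k (\<lambda>j. f (Y j)) 0"
    using assms by (simp add: if_distrib[where f = "\<lambda>x. x *\<^sub>R _"] cong: if_cong)
  then show ?thesis
    by (simp add: hbvm_path_def rk_update_def legendre_moment_def legendre01_0 hbvm_b_def)
qed

lemma hbvm_path_node:
  assumes "rk_stages k (hbvm_A k s) f h y0 Y" "i < k"
  shows "hbvm_path k s f h y0 Y (gl_node k i) = Y i"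
proof -
  have "0 \<le> gl_node k i" using gl_node_bounds[OF assms(2)] by simp
  then have "hbvm_A k s i j = (\<Sum>m<s. poly (primitive (legendre01 m)) (gl_node k i) *
      (gl_weight k j * poly (legendre01 m) (gl_node k j)))" for j
    by (simp add: hbvm_A_def integral_poly sum_distrib_right sum_distrib_left mult_ac)
  then have "(\<Sum>j<k. hbvm_A k s i j *\<^sub>R f (Y j)) =
      (\<Sum>m<s. poly (primitive (legendre01 m)) (gl_node k i) *\<^sub>R legendre_moment k (\<lambda>j. f (Y j)) m)"
    by (simp add: legendre_moment_def scaleR_sum_left scaleR_sum_right sum.swap[of _ "{..<k}"])
  then show ?thesis using assms by (simp add: rk_stages_def hbvm_path_def)
qed

lemma hbvm_path_derivative:
  "(hbvm_path k s f h y0 Y has_vector_derivative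
      h *\<^sub>R discrete_projection k s (\<lambda>j. f (Y j)) c) (at c within S)"
proof -
  show ?thesis
    unfolding hbvm_path_def[abs_def] discrete_projection_def
    by (auto intro!: derivative_eq_intros sum.cong simp: pderiv_primitive)
qed

lemma vector_poly_hbvm_path: "vector_poly s (hbvm_path k s f h y0 Y)"
proof -
  have "linear (\<lambda>x. h *\<^sub>R x)" for h :: real by (simp add: linearI scaleR_right_distrib)
  moreover have "vector_poly s (\<lambda>c. poly (primitive (legendre01 m)) c *\<^sub>R v)" if "m < s" for m v
    using that degree_primitive[of "legendre01 m"] by (intro vector_poly_poly) (simp add: degree_legendre01)
  ultimately show ?thesis unfolding hbvm_path_def[abs_def]
    by (intro vector_poly_add vector_poly_const vector_poly_linear[where L = "\<lambda>x. h *\<^sub>R x"] vector_poly_sum) auto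
qed

lemma vector_poly_discrete_projection: "vector_poly (s - 1) (discrete_projection k s g)"
  unfolding discrete_projection_def[abs_def]
  by (intro vector_poly_sum vector_poly_poly) (auto simp: degree_legendre01)

section \<open>Energy conservation\<close>

text \<open>
  The hypothesis \<open>3s \<le> 2k\<close> is what makes the quadrature exact for the derivative of \<open>H\<close> along the path, a
  polynomial of degree at most \<open>2s + (s - 1)\<close>.
\<close>

theorem hbvm_conserves_cubic:
  fixes H :: "'a::euclidean_space \<Rightarrow> real"
  assumes s: "1 \<le> s" "3 * s \<le> 2 * k"
    and G: "quadratic_map G" "\<And>y. GDERIV H y :> G y"
    and S: "linear S" "\<And>x. x \<bullet> S x = 0"
  shows "rk_conserves k (hbvm_A k s) (hbvm_b k) (\<lambda>y. S (G y)) H"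
  unfolding rk_conserves_def
proof (intro allI impI)
  fix h y0 Y
  define f where "f = (\<lambda>y. S (G y))"
  assume "rk_stages k (hbvm_A k s) (\<lambda>y. S (G y)) h y0 Y"
  then have Y: "rk_stages k (hbvm_A k s) f h y0 Y" by (simp add: f_def)
  define \<sigma> where "\<sigma> = hbvm_path k s f h y0 Y"
  define \<sigma>' where "\<sigma>' = (\<lambda>c. h *\<^sub>R discrete_projection k s (\<lambda>j. f (Y j)) c)"
  have ftc: "((\<lambda>c. G (\<sigma> c) \<bullet> \<sigma>' c) has_integral (H (\<sigma> 1) - H (\<sigma> 0))) {0..1}"
  proof (rule fundamental_theorem_of_calculus)
    fix c :: real
    have "(\<sigma> has_derivative (\<lambda>t. t *\<^sub>R \<sigma>' c)) (at c within {0..1})"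
      using hbvm_path_derivative[of k s f h y0 Y c "{0..1}"]
      by (simp add: \<sigma>_def \<sigma>'_def has_vector_derivative_def)
    from has_derivative_compose[OF this G(2)[unfolded gderiv_def]]
    show "((\<lambda>c. H (\<sigma> c)) has_vector_derivative G (\<sigma> c) \<bullet> \<sigma>' c) (at c within {0..1})"
      by (simp add: has_vector_derivative_def inner_commute mult.commute)
  qed simp
  have quad: "((\<lambda>c. G (\<sigma> c) \<bullet> \<sigma>' c) has_integral
      (\<Sum>i<k. gl_weight k i *\<^sub>R (G (\<sigma> (gl_node k i)) \<bullet> \<sigma>' (gl_node k i)))) {0..1}"
  proof (rule vector_poly_quadrature)
    have "vector_poly (s - 1) \<sigma>'" unfolding \<sigma>'_def
      by (rule vector_poly_linear[where L = "\<lambda>x. h *\<^sub>R x", OF _ vector_poly_discrete_projection])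
         (simp add: linearI scaleR_right_distrib)
    then show "vector_poly (2 * s + (s - 1)) (\<lambda>c. G (\<sigma> c) \<bullet> \<sigma>' c)"
      by (intro vector_poly_bilinear bounded_bilinear_inner vector_poly_quadratic_map G)
         (simp add: \<sigma>_def vector_poly_hbvm_path)
  qed (use s in simp)
  have "(\<Sum>i<k. gl_weight k i *\<^sub>R (G (\<sigma> (gl_node k i)) \<bullet> \<sigma>' (gl_node k i))) = 0"
  proof -
    have "(\<Sum>i<k. gl_weight k i *\<^sub>R (G (\<sigma> (gl_node k i)) \<bullet> \<sigma>' (gl_node k i))) =
        (\<Sum>i<k. gl_weight k i *\<^sub>R (G (Y i) \<bullet> \<sigma>' (gl_node k i)))"
      using hbvm_path_node[OF Y] by (simp add: \<sigma>_def)
    also have "\<dots> = (\<Sum>m<s. h * (legendre_moment k (\<lambda>j. G (Y j)) m \<bullet> legendre_moment k (\<lambda>j. f (Y j)) m))"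
    \<comment> \<open>The weights and the values of the Legendre polynomials at the nodes assemble
        to the discrete coefficients of the gradient.\<close>
    proof -
      have "(\<Sum>i<k. gl_weight k i *\<^sub>R (g i \<bullet> (h *\<^sub>R (\<Sum>m<s. poly (legendre01 m) (gl_node k i) *\<^sub>R \<gamma> m)))) =
          (\<Sum>m<s. h * (legendre_moment k g m \<bullet> \<gamma> m))" for g \<gamma> :: "nat \<Rightarrow> 'a"
        by (simp add: legendre_moment_def inner_sum_left inner_sum_right sum_distrib_left
            sum.swap[of _ "{..<s}" "{..<k}"] mult_ac)
      then show ?thesis by (simp add: \<sigma>'_def discrete_projection_def)
    qed
    also have "\<dots> = 0"
    proof -
      have "legendre_moment k (\<lambda>j. f (Y j)) m = S (legendre_moment k (\<lambda>j. G (Y j)) m)" for m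
        unfolding legendre_moment_def f_def using S(1) by (simp add: linear_sum linear_scale)
      then show ?thesis by (simp add: S(2))
    qed
    finally show ?thesis .
  qed
  then have "H (\<sigma> 1) = H (\<sigma> 0)" using has_integral_unique[OF ftc quad] by simp
  then show "H (rk_update k (hbvm_b k) (\<lambda>y. S (G y)) h y0 Y) = H y0"
    by (simp add: \<sigma>_def hbvm_path_0 hbvm_path_1[OF s(1)] flip: f_def)
qed

section \<open>Solvability of the stage equations\<close>

text \<open>
  For small \<open>h\<close> the right-hand side of the stage equations is a contraction, with constant \<open>1/2\<close> in the maximum
  norm over the stages, of the stage vectors within distance \<open>1\<close> of \<open>y0\<close>.  The number of stages is a variable, so
  the fixed point is obtained as the limit of the iteration \<open>X n\<close> in each component.  The bound on the
  distance from \<open>y0\<close> shows that the stages tend to \<open>y0\<close>.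
\<close>

lemma rk_stages_unique_solution:
  fixes f :: "'a::banach \<Rightarrow> 'a"
  defines "a \<equiv> \<lambda>k A. \<Sum>i<k. \<Sum>j<k. \<bar>A i j\<bar>"
  assumes lip: "\<And>x y. x \<in> cball y0 1 \<Longrightarrow> y \<in> cball y0 1 \<Longrightarrow> norm (f x - f y) \<le> K * norm (x - y)"
    and M: "\<And>x. x \<in> cball y0 1 \<Longrightarrow> norm (f x) \<le> M"
    and h: "\<bar>h\<bar> * a k A * K \<le> 1 / 2" "\<bar>h\<bar> * a k A * M \<le> 1" and "0 \<le> K"
  shows "\<exists>Y. rk_stages k A f h y0 Y \<and> (\<forall>i<k. norm (Y i - y0) \<le> \<bar>h\<bar> * a k A * M) \<and>
    (\<forall>Z. rk_stages k A f h y0 Z \<and> (\<forall>i<k. Z i \<in> cball y0 1) \<longrightarrow> (\<forall>i<k. Z i = Y i))"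
proof -
  define \<Phi> where "\<Phi> = (\<lambda>g i. y0 + h *\<^sub>R (\<Sum>j<k. A i j *\<^sub>R f (g j)))"
  have row: "(\<Sum>j<k. \<bar>A i j\<bar>) \<le> a k A" if "i < k" for i
    unfolding a_def using that
    by (intro member_le_sum[of i "{..<k}" "\<lambda>i. \<Sum>j<k. \<bar>A i j\<bar>"]) (auto intro: sum_nonneg)
  have a_nonneg: "0 \<le> a k A" by (auto simp: a_def intro: sum_nonneg)
  have \<Phi>_bound: "norm (\<Phi> g i - y0) \<le> \<bar>h\<bar> * a k A * M"
    if "i < k" "\<And>j. j < k \<Longrightarrow> g j \<in> cball y0 1" for g i
  proof -
    have "0 \<le> M" using order_trans[OF norm_ge_zero M[of y0]] by simp
    have "norm (\<Sum>j<k. A i j *\<^sub>R f (g j)) \<le> (\<Sum>j<k. \<bar>A i j\<bar> * M)"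
      using that(2) by (intro sum_norm_le) (auto intro!: mult_left_mono M)
    also have "\<dots> \<le> a k A * M"
      unfolding sum_distrib_right[symmetric] by (intro mult_right_mono row that \<open>0 \<le> M\<close>)
    finally show ?thesis unfolding \<Phi>_def by (simp add: mult.assoc mult_left_mono)
  qed
  have \<Phi>_lip: "norm (\<Phi> g i - \<Phi> g' i) \<le> 1 / 2 * D"
    if "i < k" "\<And>j. j < k \<Longrightarrow> g j \<in> cball y0 1" "\<And>j. j < k \<Longrightarrow> g' j \<in> cball y0 1"
      "\<And>j. j < k \<Longrightarrow> norm (g j - g' j) \<le> D" "0 \<le> D" for g g' i D
  proof -
    have "norm (\<Sum>j<k. A i j *\<^sub>R (f (g j) - f (g' j))) \<le> (\<Sum>j<k. \<bar>A i j\<bar> * (K * D))"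
    proof (rule sum_norm_le)
      fix j assume "j \<in> {..<k}"
      then have "norm (f (g j) - f (g' j)) \<le> K * D"
        using lip[of "g j" "g' j"] that \<open>0 \<le> K\<close>
        by (meson lessThan_iff mult_left_mono order_trans)
      then show "norm (A i j *\<^sub>R (f (g j) - f (g' j))) \<le> \<bar>A i j\<bar> * (K * D)"
        by (simp add: mult_left_mono)
    qed
    also have "\<dots> \<le> a k A * (K * D)"
      unfolding sum_distrib_right[symmetric] using \<open>0 \<le> K\<close> \<open>0 \<le> D\<close> that(1)
      by (intro mult_right_mono row) auto
    finally have "norm (\<Phi> g i - \<Phi> g' i) \<le> \<bar>h\<bar> * (a k A * (K * D))"
      unfolding \<Phi>_def
      by (simp add: mult_left_mono flip: scaleR_diff_right sum_subtractf)
    also have "\<dots> = (\<bar>h\<bar> * a k A * K) * D" by simp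
    also have "\<dots> \<le> 1 / 2 * D" using h(1) \<open>0 \<le> D\<close> by (rule mult_right_mono)
    finally show ?thesis .
  qed
  define X where "X = (\<lambda>n. (\<Phi> ^^ n) (\<lambda>_. y0))"
  have X_Suc: "X (Suc n) = \<Phi> (X n)" for n by (simp add: X_def)
  have X_bound: "norm (X n i - y0) \<le> \<bar>h\<bar> * a k A * M" if "i < k" for n i
    using that
  proof (induction n arbitrary: i)
    case 0
    have "0 \<le> M" using order_trans[OF norm_ge_zero M[of y0]] by simp
    then show ?case using a_nonneg by (simp add: X_def)
  next
    case (Suc n)
    have "X n j \<in> cball y0 1" if "j < k" for j
      using Suc.IH[OF that] h(2) by (simp add: dist_norm norm_minus_commute)
    then show ?case unfolding X_Suc using Suc.prems by (intro \<Phi>_bound)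
  qed
  have X_ball: "X n i \<in> cball y0 1" if "i < k" for n i
    using X_bound[OF that, of n] h(2) by (simp add: dist_norm norm_minus_commute)
  have X_step: "norm (X (Suc n) i - X n i) \<le> (1 / 2) ^ n" if "i < k" for n i
    using that
  proof (induction n arbitrary: i)
    case 0
    then show ?case using X_ball[of i 1] by (simp add: X_def dist_norm norm_minus_commute)
  next
    case (Suc n)
    then have "norm (\<Phi> (X (Suc n)) i - \<Phi> (X n) i) \<le> 1 / 2 * (1 / 2) ^ n"
      using X_ball by (intro \<Phi>_lip) auto
    then show ?case by (simp add: X_Suc)
  qed
  have "convergent (\<lambda>n. X n i)" if "i < k" for i
  proof -
    have "summable (\<lambda>n. X (Suc n) i - X n i)"
      by (rule summable_comparison_test'[of "\<lambda>n. (1 / 2 :: real) ^ n" 0])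
         (use X_step[OF that] in \<open>auto intro: summable_geometric\<close>)
    then have "convergent (\<lambda>n. \<Sum>m<n. X (Suc m) i - X m i)"
      using summable_LIMSEQ convergent_def by blast
    then have "convergent (\<lambda>n. X n i - X 0 i)" by (subst (asm) sum_lessThan_telescope[of "\<lambda>n. X n i"])
    then show ?thesis by (simp add: convergent_diff_const_right_iff)
  qed
  then obtain Y where Y: "\<And>i. i < k \<Longrightarrow> (\<lambda>n. X n i) \<longlonglongrightarrow> Y i"
    unfolding convergent_def by metis
  have Y_bound: "norm (Y i - y0) \<le> \<bar>h\<bar> * a k A * M" if "i < k" for i
    by (rule LIMSEQ_le_const2[OF tendsto_norm[OF tendsto_diff[OF Y[OF that] tendsto_const]]])
       (use X_bound[OF that] in auto)
  have Y_ball: "Y i \<in> cball y0 1" if "i < k" for i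
    using Y_bound[OF that] h(2) by (simp add: dist_norm norm_minus_commute)
  have "Y i = \<Phi> Y i" if "i < k" for i
  proof (rule LIMSEQ_unique)
    show "(\<lambda>n. X (Suc n) i) \<longlonglongrightarrow> Y i" using Y[OF that] by (rule LIMSEQ_Suc)
    have "(\<lambda>n. f (X n j)) \<longlonglongrightarrow> f (Y j)" if "j < k" for j
    proof -
      have "(\<lambda>n. f (X n j) - f (Y j)) \<longlonglongrightarrow> 0"
      proof (rule Lim_null_comparison)
        show "\<forall>\<^sub>F n in sequentially. norm (f (X n j) - f (Y j)) \<le> K * norm (X n j - Y j)"
          using lip X_ball Y_ball that by simp
        show "(\<lambda>n. K * norm (X n j - Y j)) \<longlonglongrightarrow> 0"
          using tendsto_mult_right_zero[OF tendsto_norm_zero[OF LIM_zero[OF Y[OF that]]]] .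
      qed
      then show ?thesis by (rule LIM_zero_cancel)
    qed
    then show "(\<lambda>n. X (Suc n) i) \<longlonglongrightarrow> \<Phi> Y i"
      unfolding X_Suc \<Phi>_def by (intro tendsto_intros) auto
  qed
  then have Y_stages: "rk_stages k A f h y0 Y" by (simp add: rk_stages_def \<Phi>_def)
  have "Z i = Y i" if Z: "rk_stages k A f h y0 Z" "\<And>i. i < k \<Longrightarrow> Z i \<in> cball y0 1" and "i < k" for Z i
  proof -
    define D where "D = Max ((\<lambda>j. norm (Z j - Y j)) ` {..<k})"
    have D: "norm (Z j - Y j) \<le> D" if "j < k" for j
      unfolding D_def using that by (intro Max_ge) auto
    have "D \<in> (\<lambda>j. norm (Z j - Y j)) ` {..<k}"
      unfolding D_def using \<open>i < k\<close> by (intro Max_in) auto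
    then obtain j where j: "j < k" "D = norm (Z j - Y j)" by auto
    have "norm (\<Phi> Z j - \<Phi> Y j) \<le> 1 / 2 * D"
      using j(1) Z(2) Y_ball D by (rule \<Phi>_lip) (use j(2) in auto)
    moreover have "\<Phi> Z j = Z j" "\<Phi> Y j = Y j"
      using Z(1) Y_stages j(1) by (auto simp: rk_stages_def \<Phi>_def)
    ultimately have "D \<le> 0" using j(2) by simp
    with D[OF \<open>i < k\<close>] have "norm (Z i - Y i) \<le> 0" by (rule order_trans)
    then show ?thesis by simp
  qed
  then show ?thesis using Y_stages Y_bound by blast
qed

lemma rk_stage_branch_exists:
  fixes f :: "'a::banach \<Rightarrow> 'a"
  assumes "0 \<le> K"
    and lip: "\<And>x y. x \<in> cball y0 1 \<Longrightarrow> y \<in> cball y0 1 \<Longrightarrow> norm (f x - f y) \<le> K * norm (x - y)"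
  shows "\<exists>Y. rk_stage_branch k A f y0 Y"
proof -
  define a where "a = (\<Sum>i<k. \<Sum>j<k. \<bar>A i j\<bar>)"
  define M where "M = norm (f y0) + K"
  have M: "norm (f x) \<le> M" if "x \<in> cball y0 1" for x
  proof -
    have "norm (f x - f y0) \<le> K * 1"
      using lip[of x y0] mult_left_mono[of "norm (x - y0)" 1 K] that \<open>0 \<le> K\<close>
      by (auto simp: dist_norm norm_minus_commute)
    then show ?thesis using norm_triangle_sub[of "f x" "f y0"] by (simp add: M_def)
  qed
  have "0 \<le> a" by (auto simp: a_def intro: sum_nonneg)
  have "0 \<le> M" using \<open>0 \<le> K\<close> by (simp add: M_def)
  define h0 where "h0 = 1 / (2 * (a * (K + M) + 1))"
  have den: "0 < 2 * (a * (K + M) + 1)"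
    using \<open>0 \<le> a\<close> \<open>0 \<le> K\<close> \<open>0 \<le> M\<close> by (simp add: add_nonneg_pos)
  have small: "\<bar>h\<bar> * a * K \<le> 1 / 2" "\<bar>h\<bar> * a * M \<le> 1 / 2" if "\<bar>h\<bar> < h0" for h
  proof -
    have "\<bar>h\<bar> * (2 * (a * (K + M) + 1)) < 1"
      using that den unfolding h0_def by (simp add: pos_less_divide_eq)
    moreover have "0 \<le> \<bar>h\<bar> * a * K" "0 \<le> \<bar>h\<bar> * a * M"
      using \<open>0 \<le> a\<close> \<open>0 \<le> K\<close> \<open>0 \<le> M\<close> by auto
    ultimately show "\<bar>h\<bar> * a * K \<le> 1 / 2" "\<bar>h\<bar> * a * M \<le> 1 / 2"
      by (auto simp: algebra_simps)
  qed
  define good where "good = (\<lambda>h Y. rk_stages k A f h y0 Y \<and> (\<forall>i<k. norm (Y i - y0) \<le> \<bar>h\<bar> * a * M) \<and>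
    (\<forall>Z. rk_stages k A f h y0 Z \<and> (\<forall>i<k. Z i \<in> cball y0 1) \<longrightarrow> (\<forall>i<k. Z i = Y i)))"
  have solvable: "\<exists>Y. good h Y" if "\<bar>h\<bar> < h0" for h
    unfolding good_def a_def
    by (rule rk_stages_unique_solution[OF lip M])
       (use small[OF that] \<open>0 \<le> K\<close> in \<open>auto simp: a_def\<close>)
  define Y where "Y = (\<lambda>h. SOME Y. good h Y)"
  have good: "good h (Y h)" if "\<bar>h\<bar> < h0" for h
    unfolding Y_def by (rule someI_ex[OF solvable[OF that]])
  have Y: "\<And>h. \<bar>h\<bar> < h0 \<Longrightarrow> rk_stages k A f h y0 (Y h)"
    "\<And>h i. \<bar>h\<bar> < h0 \<Longrightarrow> i < k \<Longrightarrow> norm (Y h i - y0) \<le> \<bar>h\<bar> * a * M"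
    "\<And>h i Z. \<bar>h\<bar> < h0 \<Longrightarrow> rk_stages k A f h y0 Z \<Longrightarrow> (\<forall>i<k. Z i \<in> cball y0 1) \<Longrightarrow>
       i < k \<Longrightarrow> Z i = Y h i"
    using good unfolding good_def by blast+
  have "0 < h0" using den by (simp add: h0_def)
  have "((\<lambda>h. Y h i) \<longlongrightarrow> y0) (at 0)" if "i < k" for i
  proof -
    have "((\<lambda>h. Y h i - y0) \<longlongrightarrow> 0) (at 0)"
    proof (rule Lim_null_comparison)
      show "\<forall>\<^sub>F h in at 0. norm (Y h i - y0) \<le> \<bar>h\<bar> * a * M"
        unfolding eventually_at using Y(2) that \<open>0 < h0\<close> by (auto simp: dist_norm)
      show "((\<lambda>h. \<bar>h\<bar> * a * M) \<longlongrightarrow> 0) (at (0 :: real))"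
        by (auto intro!: tendsto_eq_intros)
    qed
    then show ?thesis by (simp add: LIM_zero_iff)
  qed
  moreover have "rk_stages k A f h y0 (Y h) \<and>
      (\<forall>Z. rk_stages k A f h y0 Z \<and> (\<forall>i<k. Z i \<in> ball y0 1) \<longrightarrow> (\<forall>i<k. Z i = Y h i))"
    if "\<bar>h\<bar> < h0" for h
    using Y(1)[OF that] by (auto intro!: Y(3)[OF that] less_imp_le)
  ultimately show ?thesis
    unfolding rk_stage_branch_def using \<open>0 < h0\<close> zero_less_one by blast
qed

section \<open>Polynomial approximation of the exact solution\<close>

text \<open>
  The mean value inequality in the form in which it is applied to a step rescaled to \<open>[0, 1]\<close>.
\<close>

lemma unit_interval_growth:
  fixes g :: "real \<Rightarrow> 'a::real_normed_vector"
  assumes "\<And>c. c \<in> {0..1} \<Longrightarrow> (g has_vector_derivative g' c) (at c within {0..1})"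
    and B: "\<And>c. c \<in> {0..1} \<Longrightarrow> norm (g' c) \<le> B" and "c \<in> {0..1}"
  shows "norm (g c - g 0) \<le> B"
proof -
  have "0 \<le> B" using order_trans[OF norm_ge_zero B[of 0]] by simp
  have "norm (g c - g 0) \<le> B * norm (c - 0)"
  proof (rule differentiable_bound[of "{0..1 :: real}"])
    fix x :: real assume x: "x \<in> {0..1}"
    show "(g has_derivative (\<lambda>t. t *\<^sub>R g' x)) (at x within {0..1})"
      using assms(1)[OF x] by (simp add: has_vector_derivative_def)
    show "onorm (\<lambda>t. t *\<^sub>R g' x) \<le> B"
      using B[OF x] \<open>0 \<le> B\<close>
      by (intro onorm_le) (simp add: mult.commute[of B] mult_left_mono)
  qed (use assms in auto)
  also have "\<dots> \<le> B" using \<open>0 \<le> B\<close> assms(3) by (auto intro: mult_left_le)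
  finally show ?thesis .
qed

text \<open>
  Writing the solution as a function of \<open>c \<in> [0, 1]\<close> with \<open>t = hc\<close> treats positive and negative step sizes
  alike.
\<close>

lemma ivp_solution_scaled:
  fixes f :: "'a::real_normed_vector \<Rightarrow> 'a"
  assumes "ivp_solution f y0 I y" "h \<in> I" "c \<in> {0..1}"
  shows "h * c \<in> I"
    and "((\<lambda>c. y (h * c)) has_vector_derivative h *\<^sub>R f (y (h * c))) (at c within {0..1})"
proof -
  have I: "h * c \<in> I" if "c \<in> {0..1}" for c
    using convexD_alt[of I 0 h c] that assms
    by (auto simp: ivp_solution_def is_interval_convex mult.commute)
  then show "h * c \<in> I" using assms(3) .
  have lin: "((*) h has_vector_derivative h) (at c within {0..1})"
    by (auto intro!: derivative_eq_intros simp flip: has_real_derivative_iff_has_vector_derivative)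
  have "(y has_vector_derivative f (y (h * c))) (at (h * c) within (*) h ` {0..1})"
    by (rule has_vector_derivative_within_subset[of _ _ _ I])
       (use assms(1) I I[OF assms(3)] in \<open>auto simp: ivp_solution_def\<close>)
  from vector_diff_chain_within[OF lin this]
  show "((\<lambda>c. y (h * c)) has_vector_derivative h *\<^sub>R f (y (h * c))) (at c within {0..1})"
    by (simp add: o_def)
qed

lemma ivp_solution_near:
  assumes "ivp_solution f y0 I y"
  shows "\<exists>\<delta>>0. \<forall>t\<in>I. \<bar>t\<bar> < \<delta> \<longrightarrow> y t \<in> cball y0 1"
proof -
  have "continuous (at 0 within I) y"
    using assms by (auto simp: ivp_solution_def intro: has_vector_derivative_continuous)
  then obtain \<delta> where "\<delta> > 0" "\<And>t. t \<in> I \<Longrightarrow> dist t 0 < \<delta> \<Longrightarrow> dist (y t) (y 0) < 1"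
    unfolding continuous_within_eps_delta using zero_less_one by blast
  then show ?thesis using assms by (intro exI[of _ \<delta>]) (auto simp: ivp_solution_def dist_commute intro: less_imp_le)
qed

text \<open>
  The expansion of the solution is inserted into \<open>f\<close>, and the powers above \<open>d\<close> are dropped; near the initial
  value, \<open>f\<close> is Lipschitz continuous.
\<close>

lemma quadratic_map_along_expansion:
  assumes f: "quadratic_map f" and y: "ivp_solution f y0 I y" and "0 < \<delta>"
    and bound: "\<And>t. t \<in> I \<Longrightarrow> \<bar>t\<bar> < \<delta> \<Longrightarrow> norm (y t - (\<Sum>i\<le>d. t ^ i *\<^sub>R v i)) \<le> C * \<bar>t\<bar> ^ Suc d"
  shows "\<exists>w \<delta>' C'. 0 < \<delta>' \<and> (\<forall>t\<in>I. \<bar>t\<bar> < \<delta>' \<longrightarrow>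
    norm (f (y t) - (\<Sum>i\<le>d. t ^ i *\<^sub>R w i)) \<le> C' * \<bar>t\<bar> ^ Suc d)"
proof -
  define P where "P = (\<lambda>t. \<Sum>i\<le>d. t ^ i *\<^sub>R v i)"
  have P: "vector_poly d P" unfolding vector_poly_def P_def by blast
  have I: "0 \<in> I" "y 0 = y0" using y by (auto simp: ivp_solution_def)
  have "P 0 = y0" using bound[of 0] I \<open>0 < \<delta>\<close> by (simp add: P_def)
  obtain K where K: "0 \<le> K" "\<And>x y. x \<in> cball y0 1 \<Longrightarrow> y \<in> cball y0 1 \<Longrightarrow> norm (f x - f y) \<le> K * norm (x - y)"
    using quadratic_map_lipschitz[OF f, of y0] by auto
  obtain w C1 where w: "\<And>t. \<bar>t\<bar> \<le> 1 \<Longrightarrow> norm (f (P t) - (\<Sum>i\<le>d. t ^ i *\<^sub>R w i)) \<le> C1 * \<bar>t\<bar> ^ Suc d"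
    using vector_poly_truncate[OF vector_poly_quadratic_map[OF f P], of d] by auto
  obtain \<delta>1 where \<delta>1: "\<delta>1 > 0" "\<And>t. t \<in> I \<Longrightarrow> \<bar>t\<bar> < \<delta>1 \<Longrightarrow> y t \<in> cball y0 1"
    using ivp_solution_near[OF y] by auto
  have "continuous (at 0) P"
    using vector_poly_continuous[OF P, of UNIV] by (simp add: continuous_on_eq_continuous_at)
  then obtain \<delta>2 where \<delta>2: "\<delta>2 > 0" "\<And>t. dist t 0 < \<delta>2 \<Longrightarrow> dist (P t) (P 0) < 1"
    unfolding continuous_at_eps_delta using zero_less_one by blast
  have "norm (f (y t) - (\<Sum>i\<le>d. t ^ i *\<^sub>R w i)) \<le> (K * C + C1) * \<bar>t\<bar> ^ Suc d"
    if t: "t \<in> I" "\<bar>t\<bar> < Min {\<delta>, \<delta>1, \<delta>2, 1}" for t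
  proof -
    have "P t \<in> cball y0 1" using \<delta>2(2)[of t] t(2) \<open>P 0 = y0\<close> by (simp add: dist_commute)
    then have "norm (f (y t) - f (P t)) \<le> K * norm (y t - P t)"
      using K(2) \<delta>1(2)[OF t(1)] t(2) by simp
    also have "\<dots> \<le> K * (C * \<bar>t\<bar> ^ Suc d)"
      using bound[OF t(1)] t(2) K(1) by (intro mult_left_mono) (auto simp: P_def)
    finally have "norm (f (y t) - f (P t)) \<le> K * (C * \<bar>t\<bar> ^ Suc d)" .
    moreover have "norm (f (P t) - (\<Sum>i\<le>d. t ^ i *\<^sub>R w i)) \<le> C1 * \<bar>t\<bar> ^ Suc d"
      using w t(2) by simp
    ultimately have "norm ((f (y t) - f (P t)) + (f (P t) - (\<Sum>i\<le>d. t ^ i *\<^sub>R w i))) \<le>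
        K * (C * \<bar>t\<bar> ^ Suc d) + C1 * \<bar>t\<bar> ^ Suc d"
      by (rule norm_triangle_mono)
    then show ?thesis by (simp add: algebra_simps)
  qed
  moreover have "0 < Min {\<delta>, \<delta>1, \<delta>2, 1}" using \<open>0 < \<delta>\<close> \<delta>1 \<delta>2 by simp
  ultimately show ?thesis by blast
qed

text \<open>
  Picard iteration on polynomials: an expansion of \<open>y\<close> gives one of \<open>y' = f(y)\<close> with an error of the same order,
  and integrating it gains one power of \<open>t\<close>.  In this way no higher derivatives of \<open>y\<close> have to be
  considered.
\<close>

lemma ivp_solution_expansion:
  assumes f: "quadratic_map f" and y: "ivp_solution f y0 I y"
  shows "\<exists>v \<delta> C. 0 < \<delta> \<and> (\<forall>t\<in>I. \<bar>t\<bar> < \<delta> \<longrightarrow>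
    norm (y t - (\<Sum>i\<le>d. t ^ i *\<^sub>R v i)) \<le> C * \<bar>t\<bar> ^ Suc d)"
proof (induction d)
  case 0
  obtain K where K: "0 \<le> K" "\<And>x y. x \<in> cball y0 1 \<Longrightarrow> y \<in> cball y0 1 \<Longrightarrow> norm (f x - f y) \<le> K * norm (x - y)"
    using quadratic_map_lipschitz[OF f, of y0] by auto
  obtain \<delta> where \<delta>: "\<delta> > 0" "\<And>t. t \<in> I \<Longrightarrow> \<bar>t\<bar> < \<delta> \<Longrightarrow> y t \<in> cball y0 1"
    using ivp_solution_near[OF y] by auto
  have "norm (y t - y0) \<le> (norm (f y0) + K) * \<bar>t\<bar>" if t: "t \<in> I" "\<bar>t\<bar> < \<delta>" for t
  proof -
    have "norm (y (t * 1) - y (t * 0)) \<le> (norm (f y0) + K) * \<bar>t\<bar>"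
    proof (rule unit_interval_growth[of "\<lambda>c. y (t * c)"])
      fix c :: real assume c: "c \<in> {0..1}"
      show "((\<lambda>c. y (t * c)) has_vector_derivative t *\<^sub>R f (y (t * c))) (at c within {0..1})"
        by (rule ivp_solution_scaled[OF y t(1) c])
      have "\<bar>t * c\<bar> \<le> \<bar>t\<bar>" using c by (auto simp: abs_mult intro: mult_left_le)
      then have yt: "y (t * c) \<in> cball y0 1"
        using \<delta>(2) ivp_solution_scaled(1)[OF y t(1) c] t(2) by simp
      have "norm (f (y (t * c)) - f y0) \<le> K * norm (y (t * c) - y0)" using yt by (intro K) auto
      also have "\<dots> \<le> K * 1" using yt K(1)
        by (intro mult_left_mono) (auto simp: dist_norm norm_minus_commute)
      finally have "norm (f (y (t * c))) \<le> norm (f y0) + K"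
        using norm_triangle_sub[of "f (y (t * c))" "f y0"] by simp
      then show "norm (t *\<^sub>R f (y (t * c))) \<le> (norm (f y0) + K) * \<bar>t\<bar>"
        by (subst mult.commute) (simp add: mult_left_mono)
    qed auto
    then show ?thesis using y by (simp add: ivp_solution_def)
  qed
  then show ?case using \<delta>(1)
    by (intro exI[of _ "\<lambda>_. y0"] exI[of _ \<delta>] exI[of _ "norm (f y0) + K"]) simp
next
  case (Suc d)
  then obtain v \<delta>0 C0 where "0 < \<delta>0"
    "\<And>t. t \<in> I \<Longrightarrow> \<bar>t\<bar> < \<delta>0 \<Longrightarrow> norm (y t - (\<Sum>i\<le>d. t ^ i *\<^sub>R v i)) \<le> C0 * \<bar>t\<bar> ^ Suc d"
    by auto
  from quadratic_map_along_expansion[OF f y this] obtain w \<delta> C where \<delta>: "0 < \<delta>"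
    and w: "\<And>t. t \<in> I \<Longrightarrow> \<bar>t\<bar> < \<delta> \<Longrightarrow> norm (f (y t) - (\<Sum>i\<le>d. t ^ i *\<^sub>R w i)) \<le> C * \<bar>t\<bar> ^ Suc d"
    by blast
  \<comment> \<open>The coefficients of \<open>y0\<close> plus the integral of the expansion of \<open>f \<circ> y\<close>.\<close>
  define v' where "v' = (\<lambda>i. if i = 0 then y0 else (1 / real i) *\<^sub>R w (i - 1))"
  have sum_v': "(\<Sum>i\<le>Suc d. t ^ i *\<^sub>R v' i) = y0 + (\<Sum>i\<le>d. (t ^ Suc i / real (Suc i)) *\<^sub>R w i)" for t
    by (subst sum.atMost_Suc_shift) (simp add: v'_def del: of_nat_Suc power_Suc)
  have "norm (y t - (\<Sum>i\<le>Suc d. t ^ i *\<^sub>R v' i)) \<le> \<bar>C\<bar> * \<bar>t\<bar> ^ Suc (Suc d)"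
    if t: "t \<in> I" "\<bar>t\<bar> < \<delta>" for t
  proof -
    define g where "g = (\<lambda>c. y (t * c) - (\<Sum>i\<le>d. ((t * c) ^ Suc i / real (Suc i)) *\<^sub>R w i))"
    have "norm (g 1 - g 0) \<le> \<bar>C\<bar> * \<bar>t\<bar> ^ Suc (Suc d)"
    proof (rule unit_interval_growth)
      fix c :: real assume c: "c \<in> {0..1}"
      have "((\<lambda>c. (t * c) ^ Suc i / real (Suc i)) has_real_derivative t * (t * c) ^ i) (at c within {0..1})" for i
        by (auto intro!: derivative_eq_intros simp del: power_Suc of_nat_Suc)
      then have "((\<lambda>c. \<Sum>i\<le>d. ((t * c) ^ Suc i / real (Suc i)) *\<^sub>R w i) has_vector_derivative
          (\<Sum>i\<le>d. (t * (t * c) ^ i) *\<^sub>R w i)) (at c within {0..1})"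
        by (intro has_vector_derivative_sum)
           (auto intro!: derivative_eq_intros simp: has_real_derivative_iff_has_vector_derivative simp del: power_Suc of_nat_Suc)
      then show "(g has_vector_derivative t *\<^sub>R (f (y (t * c)) - (\<Sum>i\<le>d. (t * c) ^ i *\<^sub>R w i))) (at c within {0..1})"
        unfolding g_def using ivp_solution_scaled(2)[OF y t(1) c]
        by (auto intro!: derivative_eq_intros simp: scaleR_diff_right scaleR_sum_right simp del: power_Suc of_nat_Suc)
      have tc: "\<bar>t * c\<bar> \<le> \<bar>t\<bar>" using c by (auto simp: abs_mult intro: mult_left_le)
      then have "norm (f (y (t * c)) - (\<Sum>i\<le>d. (t * c) ^ i *\<^sub>R w i)) \<le> C * \<bar>t * c\<bar> ^ Suc d"
        using ivp_solution_scaled(1)[OF y t(1) c] t(2) by (intro w) auto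
      also have "\<dots> \<le> \<bar>C\<bar> * \<bar>t\<bar> ^ Suc d"
        using tc by (intro mult_mono power_mono) auto
      finally have "norm (f (y (t * c)) - (\<Sum>i\<le>d. (t * c) ^ i *\<^sub>R w i)) \<le> \<bar>C\<bar> * \<bar>t\<bar> ^ Suc d" .
      from mult_left_mono[OF this, of "\<bar>t\<bar>"]
      show "norm (t *\<^sub>R (f (y (t * c)) - (\<Sum>i\<le>d. (t * c) ^ i *\<^sub>R w i))) \<le> \<bar>C\<bar> * \<bar>t\<bar> ^ Suc (Suc d)"
        by (simp add: mult.left_commute)
    qed auto
    moreover have "g 1 - g 0 = y t - (\<Sum>i\<le>Suc d. t ^ i *\<^sub>R v' i)"
      unfolding sum_v' using y by (simp add: g_def ivp_solution_def)
    ultimately show ?thesis by simp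
  qed
  then show ?case using \<delta> by blast
qed

section \<open>The discrete projection onto polynomials\<close>

lemma discrete_projection_diff:
  "discrete_projection k s (\<lambda>j. g j - g' j) c = discrete_projection k s g c - discrete_projection k s g' c"
  by (simp add: discrete_projection_def legendre_moment_def scaleR_diff_right sum_subtractf)

lemma discrete_projection_sum:
  "discrete_projection k s (\<lambda>j. \<Sum>n\<in>A. g n j) c = (\<Sum>n\<in>A. discrete_projection k s (g n) c)"
proof -
  have "legendre_moment k (\<lambda>j. \<Sum>n\<in>A. g n j) m = (\<Sum>n\<in>A. legendre_moment k (g n) m)" for m
    unfolding legendre_moment_def scaleR_sum_right by (rule sum.swap)
  then show ?thesis
    unfolding discrete_projection_def by (simp only: scaleR_sum_right) (rule sum.swap)
qed

text \<open>
  The products of \<open>c\<^sup>n\<close> with the Legendre polynomials involved have degree at most \<open>2s - 2 < 2k\<close>, so the discrete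
  coefficients of \<open>c\<^sup>n\<close> are the exact ones.
\<close>

lemma discrete_legendre_expansion:
  assumes "n < s" "s \<le> k"
  shows "(\<Sum>m<s. poly (legendre01 m) c *
    (\<Sum>j<k. gl_weight k j * poly (legendre01 m) (gl_node k j) * gl_node k j ^ n)) = c ^ n"
proof -
  have "(\<Sum>j<k. gl_weight k j * poly (legendre01 m) (gl_node k j) * gl_node k j ^ n) =
      unit_integral (legendre01 m * monom 1 n)" if "m < s" for m
  proof -
    have "degree (legendre01 m * monom 1 n) < 2 * k"
      using degree_mult_le[of "legendre01 m" "monom 1 n"] that assms
      by (simp add: degree_legendre01 degree_monom_eq)
    from gauss_legendre_exact[OF this] show ?thesis by (simp add: poly_monom mult.assoc)
  qed
  then have "(\<Sum>m<s. poly (legendre01 m) c *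
      (\<Sum>j<k. gl_weight k j * poly (legendre01 m) (gl_node k j) * gl_node k j ^ n)) =
      poly (\<Sum>m<s. smult (unit_integral (legendre01 m * monom 1 n)) (legendre01 m)) c"
    by (simp add: poly_sum mult.commute)
  also have "\<dots> = c ^ n"
    using assms by (subst legendre01_expansion) (simp_all add: degree_monom_eq poly_monom)
  finally show ?thesis .
qed

lemma discrete_projection_reproduces:
  assumes "vector_poly d g" "d < s" "s \<le> k"
  shows "discrete_projection k s (\<lambda>j. g (gl_node k j)) c = g c"
proof -
  obtain v where v: "\<And>t. g t = (\<Sum>n\<le>d. t ^ n *\<^sub>R v n)" using assms(1) by (auto simp: vector_poly_def)
  have "discrete_projection k s (\<lambda>j. gl_node k j ^ n *\<^sub>R v n) c = c ^ n *\<^sub>R v n" if "n \<le> d" for n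
  proof -
    have "discrete_projection k s (\<lambda>j. gl_node k j ^ n *\<^sub>R v n) c = (\<Sum>m<s. poly (legendre01 m) c *
        (\<Sum>j<k. gl_weight k j * poly (legendre01 m) (gl_node k j) * gl_node k j ^ n)) *\<^sub>R v n"
      by (simp add: discrete_projection_def legendre_moment_def scaleR_sum_left
          scaleR_sum_right sum_distrib_left)
    then show ?thesis using discrete_legendre_expansion[of n s k c] that assms by simp
  qed
  then show ?thesis by (simp add: v discrete_projection_sum)
qed

lemma discrete_projection_bound:
  fixes k s :: nat
  shows "\<exists>\<kappa>\<ge>0. \<forall>(g :: nat \<Rightarrow> 'a::real_normed_vector) M. \<forall>c\<in>{0..1}.
    0 \<le> M \<and> (\<forall>j<k. norm (g j) \<le> M) \<longrightarrow> norm (discrete_projection k s g c) \<le> \<kappa> * M"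
proof -
  have "\<exists>B. \<forall>c\<in>{0..1}. \<bar>poly (legendre01 m) c\<bar> \<le> B" for m
  proof -
    have "bounded (poly (legendre01 m) ` {0..1})"
      by (intro compact_imp_bounded compact_continuous_image continuous_intros) auto
    then show ?thesis by (auto simp: bounded_iff)
  qed
  then obtain B where B: "\<And>m c. c \<in> {0..1} \<Longrightarrow> \<bar>poly (legendre01 m) c\<bar> \<le> B m" by metis
  then have B0: "0 \<le> B m" for m using B[of 0 m] by fastforce
  define w where "w = (\<lambda>m. \<Sum>j<k. \<bar>gl_weight k j * poly (legendre01 m) (gl_node k j)\<bar>)"
  have w0: "0 \<le> w m" for m unfolding w_def by (simp add: sum_nonneg)
  have "norm (discrete_projection k s g c) \<le> (\<Sum>m<s. B m * w m) * M"
    if "c \<in> {0..1}" "0 \<le> M" "\<And>j. j < k \<Longrightarrow> norm (g j) \<le> M" for g :: "nat \<Rightarrow> 'a" and M c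
  proof -
    have "norm (legendre_moment k g m) \<le> w m * M" for m
      unfolding legendre_moment_def w_def sum_distrib_right
      using that(3) by (intro sum_norm_le) (auto intro!: mult_left_mono)
    then have "norm (discrete_projection k s g c) \<le> (\<Sum>m<s. B m * (w m * M))"
      unfolding discrete_projection_def using B[OF that(1)] B0
      by (intro sum_norm_le) (auto intro!: mult_mono)
    then show ?thesis by (simp add: sum_distrib_right mult.assoc)
  qed
  moreover have "0 \<le> (\<Sum>m<s. B m * w m)" using B0 w0 by (intro sum_nonneg) auto
  ultimately show ?thesis by blast
qed

text \<open>
  With respect to the discrete inner product of the quadrature formula, the residual is orthogonal to the
  monomials of degree below \<open>s\<close>, because the projection is symmetric and reproduces them.
\<close>

lemma discrete_projection_orthogonal:
  assumes "n < s" "s \<le> k"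
  shows "(\<Sum>j<k. (gl_weight k j * gl_node k j ^ n) *\<^sub>R
    (discrete_projection k s g (gl_node k j) - g j)) = 0"
proof -
  define P where "P = (\<lambda>m j. poly (legendre01 m) (gl_node k j))"
  have "(\<Sum>j<k. (gl_weight k j * gl_node k j ^ n) *\<^sub>R discrete_projection k s g (gl_node k j)) =
      (\<Sum>j<k. \<Sum>m<s. (gl_weight k j * gl_node k j ^ n * P m j) *\<^sub>R legendre_moment k g m)"
    by (simp add: discrete_projection_def P_def scaleR_sum_right)
  also have "\<dots> = (\<Sum>m<s. (\<Sum>j<k. gl_weight k j * P m j * gl_node k j ^ n) *\<^sub>R legendre_moment k g m)"
    by (subst sum.swap) (simp add: scaleR_sum_left mult_ac)
  also have "\<dots> = (\<Sum>m<s. \<Sum>l<k. (gl_weight k l * (P m l *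
      (\<Sum>j<k. gl_weight k j * P m j * gl_node k j ^ n))) *\<^sub>R g l)"
    by (simp add: legendre_moment_def P_def scaleR_sum_right mult_ac)
  also have "\<dots> = (\<Sum>l<k. (gl_weight k l * (\<Sum>m<s. P m l *
      (\<Sum>j<k. gl_weight k j * P m j * gl_node k j ^ n))) *\<^sub>R g l)"
    by (subst sum.swap) (simp add: scaleR_sum_left sum_distrib_left)
  also have "\<dots> = (\<Sum>l<k. (gl_weight k l * gl_node k l ^ n) *\<^sub>R g l)"
    unfolding P_def by (simp only: discrete_legendre_expansion[OF assms])
  finally show ?thesis by (simp add: scaleR_diff_right sum_subtractf)
qed

text \<open>
  The bound \<open>d + s \<le> 2k\<close> makes the quadrature exact on the residual of a polynomial of degree \<open>d\<close> times a monomial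
  of degree below \<open>s\<close>, and so turns discrete into continuous orthogonality.
\<close>

lemma projection_defect_orthogonal:
  fixes F :: "real \<Rightarrow> 'a::banach"
  assumes F: "vector_poly d F" and "n < s" "s \<le> k" "s \<le> d" "d + s \<le> 2 * k"
  shows "((\<lambda>c. c ^ n *\<^sub>R (discrete_projection k s (\<lambda>j. F (gl_node k j)) c - F c)) has_integral 0) {0..1}"
proof -
  have "vector_poly d (discrete_projection k s (\<lambda>j. F (gl_node k j)))"
    by (rule vector_poly_mono[OF vector_poly_discrete_projection]) (use assms in simp)
  moreover have "vector_poly d (\<lambda>c. - F c)"
    by (rule vector_poly_linear[OF _ F]) (simp add: linear_iff)
  ultimately have "vector_poly d (\<lambda>c. discrete_projection k s (\<lambda>j. F (gl_node k j)) c - F c)"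
    using vector_poly_add by fastforce
  moreover have "vector_poly n (\<lambda>c :: real. c ^ n)"
    using vector_poly_monomial[of n n "1 :: real"] by simp
  ultimately have "vector_poly (n + d)
      (\<lambda>c. c ^ n *\<^sub>R (discrete_projection k s (\<lambda>j. F (gl_node k j)) c - F c))"
    by (intro vector_poly_bilinear bounded_bilinear_scaleR)
  from vector_poly_quadrature[OF this, of k] show ?thesis
    using discrete_projection_orthogonal[OF assms(2,3), of "\<lambda>j. F (gl_node k j)"] assms
    by simp
qed

section \<open>Uniform error of the path\<close>

text \<open>
  The derivative of \<open>E(c) = \<sigma>(c) - y(hc)\<close> is \<open>h\<close> times \<open>\<Pi>(f(\<sigma>)) - f(z)\<close>, where \<open>\<Pi>\<close> is the discrete projection and
  \<open>z(c) = y(hc)\<close>.  With a polynomial \<open>T\<close> of degree \<open>r = s - 1\<close> that is \<open>O(h\<^sup>s)\<close>-close to \<open>f(z)\<close>, this is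
  \<open>\<Pi>(f(\<sigma>) - f(z)) + \<Pi>(f(z) - T) + (T - f(z))\<close>.  The first term is bounded by a multiple of the maximum of
  \<open>|E|\<close> and, because of the factor \<open>h\<close>, can be absorbed; the others are \<open>O(h\<^sup>s)\<close>.
\<close>

lemma hbvm_path_error:
  fixes f :: "'a::euclidean_space \<Rightarrow> 'a"
  assumes f: "quadratic_map f" and "s = Suc r" "s \<le> k" and y: "ivp_solution f y0 I y"
  shows "\<exists>C h1. 0 \<le> C \<and> 0 < h1 \<and> (\<forall>h\<in>I. \<bar>h\<bar> < h1 \<longrightarrow> (\<forall>Y c.
    rk_stages k (hbvm_A k s) f h y0 Y \<and> (\<forall>i<k. Y i \<in> cball y0 1) \<and> c \<in> {0..1} \<longrightarrow>
    norm (hbvm_path k s f h y0 Y c - y (h * c)) \<le> C * \<bar>h\<bar> ^ (r + 2)))"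
proof -
  obtain K where K: "0 \<le> K" "\<And>x y. x \<in> cball y0 1 \<Longrightarrow> y \<in> cball y0 1 \<Longrightarrow> norm (f x - f y) \<le> K * norm (x - y)"
    using quadratic_map_lipschitz[OF f, of y0] by auto
  obtain \<delta> where \<delta>: "\<delta> > 0" "\<And>t. t \<in> I \<Longrightarrow> \<bar>t\<bar> < \<delta> \<Longrightarrow> y t \<in> cball y0 1"
    using ivp_solution_near[OF y] by auto
  obtain v \<delta>v Cv where "0 < \<delta>v"
    "\<And>t. t \<in> I \<Longrightarrow> \<bar>t\<bar> < \<delta>v \<Longrightarrow> norm (y t - (\<Sum>i\<le>r. t ^ i *\<^sub>R v i)) \<le> Cv * \<bar>t\<bar> ^ Suc r"
    using ivp_solution_expansion[OF f y, of r] by auto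
  from quadratic_map_along_expansion[OF f y this] obtain w \<delta>w Cw where \<delta>w: "0 < \<delta>w"
    and w: "\<And>t. t \<in> I \<Longrightarrow> \<bar>t\<bar> < \<delta>w \<Longrightarrow> norm (f (y t) - (\<Sum>i\<le>r. t ^ i *\<^sub>R w i)) \<le> Cw * \<bar>t\<bar> ^ Suc r"
    by blast
  obtain \<kappa> where \<kappa>: "0 \<le> \<kappa>" "\<And>(g :: nat \<Rightarrow> 'a) M c. c \<in> {0..1} \<Longrightarrow> 0 \<le> M \<Longrightarrow>
      (\<And>j. j < k \<Longrightarrow> norm (g j) \<le> M) \<Longrightarrow> norm (discrete_projection k s g c) \<le> \<kappa> * M"
    using discrete_projection_bound[of k s, where ?'a = 'a] by auto
  define C where "C = 2 * ((\<kappa> + 1) * \<bar>Cw\<bar>)"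
  \<comment> \<open>The last entry makes \<open>|h| \<kappa> K \<le> 1/2\<close>.\<close>
  define h1 where "h1 = Min {\<delta>, \<delta>w, 1 / (2 * (\<kappa> * K + 1))}"
  have pos: "0 < 2 * (\<kappa> * K + 1)" using \<kappa>(1) K(1) by (simp add: add_nonneg_pos)
  have "norm (hbvm_path k s f h y0 Y c - y (h * c)) \<le> C * \<bar>h\<bar> ^ (r + 2)"
    if h: "h \<in> I" "\<bar>h\<bar> < h1" and Y: "rk_stages k (hbvm_A k s) f h y0 Y" "\<And>i. i < k \<Longrightarrow> Y i \<in> cball y0 1"
      and c: "c \<in> {0..1}" for h Y c
  proof -
    define z where "z = (\<lambda>c. y (h * c))"
    define E where "E = (\<lambda>c. hbvm_path k s f h y0 Y c - z c)"
    define T where "T = (\<lambda>c. \<Sum>i\<le>r. (h * c) ^ i *\<^sub>R w i)"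
    have hs: "\<bar>h\<bar> < \<delta>" "\<bar>h\<bar> < \<delta>w" "\<bar>h\<bar> * (\<kappa> * K) \<le> 1 / 2"
    proof -
      have "\<bar>h\<bar> * (2 * (\<kappa> * K + 1)) < 1"
        using h(2) pos unfolding h1_def by (simp add: pos_less_divide_eq)
      then show "\<bar>h\<bar> * (\<kappa> * K) \<le> 1 / 2" by (simp add: algebra_simps)
    qed (use h(2) in \<open>auto simp: h1_def\<close>)
    have hc: "\<bar>h * c\<bar> \<le> \<bar>h\<bar>" if "c \<in> {0..1}" for c
      using that by (auto simp: abs_mult intro: mult_left_le)
    have z_ball: "z c \<in> cball y0 1" if "c \<in> {0..1}" for c
      unfolding z_def using ivp_solution_scaled(1)[OF y h(1) that] hc[OF that] hs(1) by (intro \<delta>(2)) auto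
    have fz: "norm (f (z c) - T c) \<le> \<bar>Cw\<bar> * \<bar>h\<bar> ^ Suc r" if "c \<in> {0..1}" for c
    proof -
      have "norm (f (z c) - T c) \<le> Cw * \<bar>h * c\<bar> ^ Suc r"
        unfolding z_def T_def
        using ivp_solution_scaled(1)[OF y h(1) that] hc[OF that] hs(2) by (intro w) auto
      also have "\<dots> \<le> \<bar>Cw\<bar> * \<bar>h\<bar> ^ Suc r" using hc[OF that] by (intro mult_mono power_mono) auto
      finally show ?thesis .
    qed
    have T: "vector_poly r T"
    proof -
      have "T = (\<lambda>c. \<Sum>i\<le>r. c ^ i *\<^sub>R (h ^ i *\<^sub>R w i))"
        by (simp add: T_def power_mult_distrib mult.commute)
      then show ?thesis unfolding vector_poly_def by (intro exI[of _ "\<lambda>i. h ^ i *\<^sub>R w i"]) simp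
    qed
    have node: "gl_node k j \<in> {0..1}" if "j < k" for j using gl_node_bounds[OF that] by auto
    have E': "(E has_vector_derivative h *\<^sub>R (discrete_projection k s (\<lambda>j. f (Y j)) c - f (z c)))
        (at c within {0..1})" if "c \<in> {0..1}" for c
      unfolding E_def z_def scaleR_diff_right
      by (intro has_vector_derivative_diff hbvm_path_derivative ivp_solution_scaled(2)[OF y h(1) that])
    have "continuous_on {0..1} (\<lambda>c. norm (E c))"
      by (intro continuous_on_norm continuous_on_vector_derivative[OF E'])
    then obtain c0 where c0: "c0 \<in> {0..1}" "\<And>c. c \<in> {0..1} \<Longrightarrow> norm (E c) \<le> norm (E c0)"
      using continuous_attains_sup[of "{0..1 :: real}" "\<lambda>c. norm (E c)"] by auto
    define M where "M = norm (E c0)"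
    have "norm (E c0 - E 0) \<le> \<bar>h\<bar> * (\<kappa> * (K * M) + \<kappa> * (\<bar>Cw\<bar> * \<bar>h\<bar> ^ Suc r) + \<bar>Cw\<bar> * \<bar>h\<bar> ^ Suc r)"
    proof (rule unit_interval_growth[OF E' _ c0(1)])
      fix c :: real assume c: "c \<in> {0..1}"
      have "discrete_projection k s (\<lambda>j. f (Y j)) c - f (z c) =
          discrete_projection k s (\<lambda>j. f (Y j) - f (z (gl_node k j))) c +
          discrete_projection k s (\<lambda>j. f (z (gl_node k j)) - T (gl_node k j)) c + (T c - f (z c))"
        unfolding discrete_projection_diff
        using discrete_projection_reproduces[OF T, of s k c] assms by simp
      moreover have "norm (discrete_projection k s (\<lambda>j. f (Y j) - f (z (gl_node k j))) c) \<le> \<kappa> * (K * M)"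
      proof (rule \<kappa>(2)[OF c])
        show "norm (f (Y j) - f (z (gl_node k j))) \<le> K * M" if "j < k" for j
        proof -
          have "norm (f (Y j) - f (z (gl_node k j))) \<le> K * norm (Y j - z (gl_node k j))"
            using Y(2) z_ball node that by (intro K(2)) auto
          also have "Y j - z (gl_node k j) = E (gl_node k j)"
            using hbvm_path_node[OF Y(1) that] by (simp add: E_def)
          also have "K * norm (E (gl_node k j)) \<le> K * M"
            unfolding M_def using c0(2) node that K(1) by (intro mult_left_mono) auto
          finally show ?thesis .
        qed
      qed (use K(1) in \<open>simp add: M_def\<close>)
      moreover have "norm (discrete_projection k s (\<lambda>j. f (z (gl_node k j)) - T (gl_node k j)) c) \<le>
          \<kappa> * (\<bar>Cw\<bar> * \<bar>h\<bar> ^ Suc r)"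
        using fz node by (intro \<kappa>(2)[OF c]) auto
      moreover have "norm (T c - f (z c)) \<le> \<bar>Cw\<bar> * \<bar>h\<bar> ^ Suc r"
        using fz[OF c] by (simp add: norm_minus_commute)
      ultimately have "norm (discrete_projection k s (\<lambda>j. f (Y j)) c - f (z c)) \<le>
          \<kappa> * (K * M) + \<kappa> * (\<bar>Cw\<bar> * \<bar>h\<bar> ^ Suc r) + \<bar>Cw\<bar> * \<bar>h\<bar> ^ Suc r"
        by (simp only:) (intro norm_triangle_mono)
      from mult_left_mono[OF this, of "\<bar>h\<bar>"]
      show "norm (h *\<^sub>R (discrete_projection k s (\<lambda>j. f (Y j)) c - f (z c))) \<le>
          \<bar>h\<bar> * (\<kappa> * (K * M) + \<kappa> * (\<bar>Cw\<bar> * \<bar>h\<bar> ^ Suc r) + \<bar>Cw\<bar> * \<bar>h\<bar> ^ Suc r)" by simp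
    qed
    moreover have "E 0 = 0" using y by (simp add: E_def z_def hbvm_path_0 ivp_solution_def)
    ultimately have "M \<le> (\<bar>h\<bar> * (\<kappa> * K)) * M + (\<kappa> + 1) * \<bar>Cw\<bar> * \<bar>h\<bar> ^ (r + 2)"
      by (simp add: M_def algebra_simps)
    also have "\<dots> \<le> 1 / 2 * M + (\<kappa> + 1) * \<bar>Cw\<bar> * \<bar>h\<bar> ^ (r + 2)"
      using hs(3) by (intro add_right_mono mult_right_mono) (auto simp: M_def)
    finally have "M \<le> 2 * ((\<kappa> + 1) * \<bar>Cw\<bar> * \<bar>h\<bar> ^ (r + 2))" by linarith
    then have "M \<le> C * \<bar>h\<bar> ^ (r + 2)" by (simp only: C_def mult.assoc)
    moreover have "norm (E c) \<le> M" using c0(2)[OF c] by (simp add: M_def)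
    ultimately show ?thesis by (simp add: E_def z_def)
  qed
  moreover have "0 \<le> C" using \<kappa>(1) by (simp add: C_def)
  moreover have "0 < h1" using \<delta>(1) \<delta>w pos by (simp add: h1_def)
  ultimately show ?thesis by blast
qed

section \<open>Superconvergence at the end of the step\<close>

text \<open>
  The arithmetic of the superconvergence argument, with \<open>\<eta> = |h|\<close>, \<open>\<epsilon> = |E(1)|\<close>, \<open>m i\<close> and \<open>n i\<close> the norms of the
  \<open>i\<close>-th moments of \<open>E\<close> and \<open>E'\<close>, and \<open>r = s - 1\<close>.  The claim behind it is \<open>m i \<le> K (\<epsilon> + \<eta>\<^sup>2\<^sup>s\<^sup>-\<^sup>i)\<close>.  For \<open>i \<ge> r\<close> this is no
  more than the uniform bound on \<open>E\<close>.  Below, the bound on \<open>n (i + 1)\<close> only involves \<open>m (i + 1 + j)\<close> with a factor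
  \<open>\<eta>\<^sup>j\<^sup>+\<^sup>1\<close>, which makes up for the exponent lost by raising the index, so the claim descends from \<open>r\<close> to \<open>0\<close>.
  Inserting it into the bound on \<open>n 0\<close> gives one more factor \<open>\<eta>\<close>.  The constant must not depend on \<open>\<eta>\<close>, hence the
  quantification over all data inside.
\<close>

lemma moment_bootstrap:
  fixes a C :: real
  assumes "0 \<le> a" "0 \<le> C"
  shows "\<exists>K\<ge>0. \<forall>\<eta> \<epsilon> (m :: nat \<Rightarrow> real) n. 0 \<le> \<eta> \<and> \<eta> \<le> 1 \<and> 0 \<le> \<epsilon> \<and>
    (\<forall>i. m i \<le> C * \<eta> ^ (r + 2)) \<and> (\<forall>i<r. m i \<le> \<epsilon> + n (Suc i)) \<and> \<epsilon> \<le> n 0 \<and>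
    (\<forall>i\<le>r. n i \<le> \<eta> * ((\<Sum>j\<le>r. \<eta> ^ j * (a * m (i + j))) + C * \<eta> ^ (2 * r + 3))) \<longrightarrow>
    \<epsilon> \<le> K * (\<eta> * \<epsilon> + \<eta> ^ (2 * r + 3))"
proof -
  define hyp where "hyp = (\<lambda>\<eta> \<epsilon> (m :: nat \<Rightarrow> real) n. 0 \<le> \<eta> \<and> \<eta> \<le> 1 \<and> 0 \<le> \<epsilon> \<and>
    (\<forall>i. m i \<le> C * \<eta> ^ (r + 2)) \<and> (\<forall>i<r. m i \<le> \<epsilon> + n (Suc i)) \<and> \<epsilon> \<le> n 0 \<and>
    (\<forall>i\<le>r. n i \<le> \<eta> * ((\<Sum>j\<le>r. \<eta> ^ j * (a * m (i + j))) + C * \<eta> ^ (2 * r + 3))))"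
  have sum_bound: "(\<Sum>j\<le>r. \<eta> ^ j * (a * m (i + j))) \<le> (\<Sum>j\<le>r. a * K * (\<eta> ^ j * (\<epsilon> + \<eta> ^ (2 * r + 2 - (i + j)))))"
    if "0 \<le> \<eta>" "\<And>j. m (i + j) \<le> K * (\<epsilon> + \<eta> ^ (2 * r + 2 - (i + j)))" for \<eta> \<epsilon> K :: real and m :: "nat \<Rightarrow> real" and i
  proof (rule sum_mono)
    fix j
    have "\<eta> ^ j * (a * m (i + j)) \<le> \<eta> ^ j * (a * (K * (\<epsilon> + \<eta> ^ (2 * r + 2 - (i + j)))))"
      using that assms by (intro mult_left_mono) auto
    then show "\<eta> ^ j * (a * m (i + j)) \<le> a * K * (\<eta> ^ j * (\<epsilon> + \<eta> ^ (2 * r + 2 - (i + j))))"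
      by (simp add: mult_ac)
  qed
  \<comment> \<open>The exponents are natural numbers: for \<open>i > 2r + 2\<close> the difference is \<open>0\<close>, and the
      claim still follows from \<open>\<eta> \<le> 1\<close>.\<close>
  have moments: "\<exists>K\<ge>0. \<forall>\<eta> \<epsilon> m n i. hyp \<eta> \<epsilon> m n \<and> r \<le> i + p \<longrightarrow> m i \<le> K * (\<epsilon> + \<eta> ^ (2 * r + 2 - i))" for p
  proof (induction p)
    case 0
    have "m i \<le> C * (\<epsilon> + \<eta> ^ (2 * r + 2 - i))" if "hyp \<eta> \<epsilon> m n" "r \<le> i" for \<eta> \<epsilon> m n i
    proof -
      have "m i \<le> C * \<eta> ^ (r + 2)" using that by (simp add: hyp_def)
      also have "\<dots> \<le> C * (\<epsilon> + \<eta> ^ (2 * r + 2 - i))"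
      proof (intro mult_left_mono)
        have "\<eta> ^ (r + 2) \<le> \<eta> ^ (2 * r + 2 - i)"
          using that by (intro power_decreasing) (auto simp: hyp_def)
        then show "\<eta> ^ (r + 2) \<le> \<epsilon> + \<eta> ^ (2 * r + 2 - i)" using that by (simp add: hyp_def)
      qed (use assms in simp)
      finally show ?thesis .
    qed
    then show ?case using assms by (intro exI[of _ C]) auto
  next
    case (Suc p)
    then obtain K where K: "0 \<le> K"
      "\<And>\<eta> \<epsilon> m n i. hyp \<eta> \<epsilon> m n \<Longrightarrow> r \<le> i + p \<Longrightarrow> m i \<le> K * (\<epsilon> + \<eta> ^ (2 * r + 2 - i))" by blast
    define K' where "K' = 1 + real (Suc r) * (a * K) + C + K"
    have "m i \<le> K' * (\<epsilon> + \<eta> ^ (2 * r + 2 - i))" if hyp: "hyp \<eta> \<epsilon> m n" and i: "r \<le> i + Suc p" for \<eta> \<epsilon> m n i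
    proof -
      define X where "X = \<epsilon> + \<eta> ^ (2 * r + 2 - i)"
      have \<eta>: "0 \<le> \<eta>" "\<eta> \<le> 1" and \<epsilon>: "0 \<le> \<epsilon>" using hyp by (auto simp: hyp_def)
      have X: "0 \<le> X" "\<epsilon> \<le> X" "\<eta> ^ (2 * r + 2 - i) \<le> X" using \<eta> \<epsilon> by (auto simp: X_def)
      show ?thesis
      proof (cases "r \<le> i + p")
        case True
        have "m i \<le> K * X" using K(2)[OF hyp True] by (simp add: X_def)
        also have "\<dots> \<le> K' * X" using X(1) assms K(1) by (intro mult_right_mono) (auto simp: K'_def)
        finally show ?thesis by (simp add: X_def)
      next
        case False
        have Suc_i: "m (Suc i + j) \<le> K * (\<epsilon> + \<eta> ^ (2 * r + 2 - (Suc i + j)))" for j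
          using K(2)[OF hyp, of "Suc i + j"] i by simp
        have "i < r" using False by simp
        then have "m i \<le> \<epsilon> + n (Suc i)" using hyp by (simp add: hyp_def)
        moreover have "\<forall>i\<le>r. n i \<le> \<eta> * ((\<Sum>j\<le>r. \<eta> ^ j * (a * m (i + j))) + C * \<eta> ^ (2 * r + 3))"
          using hyp unfolding hyp_def by blast
        then have "n (Suc i) \<le> \<eta> * ((\<Sum>j\<le>r. \<eta> ^ j * (a * m (Suc i + j))) + C * \<eta> ^ (2 * r + 3))"
          using \<open>i < r\<close> Suc_leI by blast
        ultimately have "m i \<le> \<epsilon> + \<eta> * ((\<Sum>j\<le>r. \<eta> ^ j * (a * m (Suc i + j))) + C * \<eta> ^ (2 * r + 3))"
          by linarith
        also have "\<dots> \<le> \<epsilon> + \<eta> * ((\<Sum>j\<le>r. a * K * (\<eta> ^ j * (\<epsilon> + \<eta> ^ (2 * r + 2 - (Suc i + j))))) + C * \<eta> ^ (2 * r + 3))"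
          using sum_bound[OF \<eta>(1) Suc_i] \<eta> by (intro add_left_mono mult_left_mono add_right_mono) auto
        also have "\<dots> = \<epsilon> + (\<Sum>j\<le>r. a * K * (\<eta> ^ Suc j * \<epsilon> + \<eta> ^ (Suc j + (2 * r + 2 - (Suc i + j))))) + C * \<eta> ^ (2 * r + 4)"
        proof -
          have "\<eta> * \<eta> ^ (2 * r + 3) = \<eta> ^ (2 * r + 4)" by (simp add: numeral_eq_Suc)
          then have "\<eta> * (C * \<eta> ^ (2 * r + 3)) = C * \<eta> ^ (2 * r + 4)" by (simp add: mult.left_commute)
          moreover have "\<eta> * (\<Sum>j\<le>r. a * K * (\<eta> ^ j * (\<epsilon> + \<eta> ^ (2 * r + 2 - (Suc i + j))))) =
              (\<Sum>j\<le>r. a * K * (\<eta> ^ Suc j * \<epsilon> + \<eta> ^ (Suc j + (2 * r + 2 - (Suc i + j)))))"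
            unfolding sum_distrib_left
            by (intro sum.cong refl) (simp only: power_add power_Suc ring_distribs mult_ac)
          ultimately show ?thesis by (simp only: distrib_left add.assoc)
        qed
        also have "\<dots> \<le> X + (\<Sum>j\<le>r. a * K * X) + C * X"
        proof (intro add_mono sum_mono mult_left_mono)
          fix j
          have "\<eta> ^ Suc j * \<epsilon> \<le> \<epsilon>" using \<eta> \<epsilon> by (intro mult_left_le_one_le power_le_one) auto
          moreover have "\<eta> ^ (Suc j + (2 * r + 2 - (Suc i + j))) \<le> \<eta> ^ (2 * r + 2 - i)"
            using \<eta> by (intro power_decreasing) auto
          ultimately show "\<eta> ^ Suc j * \<epsilon> + \<eta> ^ (Suc j + (2 * r + 2 - (Suc i + j))) \<le> X"
            by (simp add: X_def)
          have "\<eta> ^ (2 * r + 4) \<le> \<eta> ^ (2 * r + 2 - i)" using \<eta> by (intro power_decreasing) auto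
          then show "\<eta> ^ (2 * r + 4) \<le> X" using X(3) by simp
        qed (use X assms K(1) in auto)
        also have "\<dots> = (K' - K) * X" by (simp add: K'_def algebra_simps)
        also have "\<dots> \<le> K' * X" using X(1) K(1) by (intro mult_right_mono) auto
        finally show ?thesis by (simp add: X_def)
      qed
    qed
    moreover have "0 \<le> K'" using assms K(1) by (simp add: K'_def)
    ultimately show ?case by blast
  qed
  obtain K where K: "0 \<le> K"
    "\<And>\<eta> \<epsilon> m n i. hyp \<eta> \<epsilon> m n \<Longrightarrow> m i \<le> K * (\<epsilon> + \<eta> ^ (2 * r + 2 - i))"
    using moments[of r] le_add2 by blast
  define K' where "K' = real (Suc r) * (a * K) + C"
  have "\<epsilon> \<le> K' * (\<eta> * \<epsilon> + \<eta> ^ (2 * r + 3))" if hyp: "hyp \<eta> \<epsilon> m n" for \<eta> \<epsilon> m n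
  proof -
    define X where "X = \<eta> * \<epsilon> + \<eta> ^ (2 * r + 3)"
    have \<eta>: "0 \<le> \<eta>" "\<eta> \<le> 1" and \<epsilon>: "0 \<le> \<epsilon>" using hyp by (auto simp: hyp_def)
    have m: "m (0 + j) \<le> K * (\<epsilon> + \<eta> ^ (2 * r + 2 - (0 + j)))" for j using K(2)[OF hyp] by simp
    have "\<epsilon> \<le> n 0" using hyp by (simp add: hyp_def)
    also have "\<dots> \<le> \<eta> * ((\<Sum>j\<le>r. \<eta> ^ j * (a * m (0 + j))) + C * \<eta> ^ (2 * r + 3))"
      using hyp unfolding hyp_def by blast
    also have "\<dots> \<le> \<eta> * ((\<Sum>j\<le>r. a * K * (\<eta> ^ j * (\<epsilon> + \<eta> ^ (2 * r + 2 - (0 + j))))) + C * \<eta> ^ (2 * r + 3))"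
      using sum_bound[OF \<eta>(1) m] \<eta> by (intro mult_left_mono add_right_mono) auto
    also have "\<dots> = (\<Sum>j\<le>r. a * K * (\<eta> ^ j * (\<eta> * \<epsilon>) + \<eta> ^ (2 * r + 3))) + C * (\<eta> * \<eta> ^ (2 * r + 3))"
    proof -
      have "\<eta> * (a * K * (\<eta> ^ j * (\<epsilon> + \<eta> ^ (2 * r + 2 - (0 + j))))) =
          a * K * (\<eta> ^ j * (\<eta> * \<epsilon>) + \<eta> ^ (2 * r + 3))" if "j \<le> r" for j
      proof -
        have "2 * r + 3 = Suc (j + (2 * r + 2 - (0 + j)))" using that by simp
        then have "\<eta> ^ (2 * r + 3) = \<eta> * (\<eta> ^ j * \<eta> ^ (2 * r + 2 - (0 + j)))"
          by (simp only: power_Suc power_add)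
        then show ?thesis by (simp only: ring_distribs mult_ac)
      qed
      then have "\<eta> * (\<Sum>j\<le>r. a * K * (\<eta> ^ j * (\<epsilon> + \<eta> ^ (2 * r + 2 - (0 + j))))) =
          (\<Sum>j\<le>r. a * K * (\<eta> ^ j * (\<eta> * \<epsilon>) + \<eta> ^ (2 * r + 3)))"
        unfolding sum_distrib_left by (intro sum.cong) auto
      then show ?thesis by (simp only: distrib_left mult.left_commute)
    qed
    also have "\<dots> \<le> (\<Sum>j\<le>r. a * K * X) + C * X"
    proof (intro add_mono sum_mono mult_left_mono)
      fix j
      have "\<eta> ^ j * (\<eta> * \<epsilon>) \<le> \<eta> * \<epsilon>" using \<eta> \<epsilon> by (intro mult_left_le_one_le power_le_one) auto
      then show "\<eta> ^ j * (\<eta> * \<epsilon>) + \<eta> ^ (2 * r + 3) \<le> X" by (simp add: X_def)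
      have "\<eta> * \<eta> ^ (2 * r + 3) \<le> \<eta> ^ (2 * r + 3)" using \<eta> by (intro mult_left_le_one_le) auto
      then show "\<eta> * \<eta> ^ (2 * r + 3) \<le> X" using \<eta> \<epsilon> by (simp add: X_def add_increasing)
    qed (use assms K(1) in auto)
    also have "\<dots> = K' * X" by (simp add: K'_def algebra_simps)
    finally show ?thesis by (simp add: X_def)
  qed
  moreover have "0 \<le> K'" using assms K(1) by (simp add: K'_def)
  ultimately show ?thesis unfolding hyp_def by blast
qed

text \<open>
  Because \<open>f\<close> is quadratic, \<open>f(\<sigma>) - f(z) = L E + B(z, E) + B(E, z) + B(E, E)\<close> exactly.  Expanding \<open>z(c) = y(hc)\<close>
  in powers of \<open>hc\<close> up to degree \<open>r = s - 1\<close>, with remainder \<open>R\<close>, turns this into a sum of terms \<open>(hc)\<^sup>j A\<^sub>j E(c)\<close> and a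
  rest \<open>\<rho>\<close>.  Each term of \<open>\<rho>\<close> is bilinear in \<open>E = O(h\<^sup>s\<^sup>+\<^sup>1)\<close> and \<open>R = O(h\<^sup>s)\<close> or quadratic in \<open>E\<close>, whence
  \<open>\<rho> = O(h\<^sup>2\<^sup>s\<^sup>+\<^sup>1)\<close>.  The \<open>i\<close>-th moment of \<open>E'\<close> is thus expressed by the moments of \<open>E\<close>; the defect contributes nothing
  for \<open>i < s\<close>.
\<close>

lemma hbvm_path_endpoint_error:
  fixes f :: "'a::euclidean_space \<Rightarrow> 'a"
  assumes f: "quadratic_map f" and s: "s = Suc r" "3 * s \<le> 2 * k" and y: "ivp_solution f y0 I y"
  shows "\<exists>C h1. 0 < h1 \<and> (\<forall>h\<in>I. \<bar>h\<bar> < h1 \<longrightarrow> (\<forall>Y.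
    rk_stages k (hbvm_A k s) f h y0 Y \<and> (\<forall>i<k. Y i \<in> cball y0 1) \<longrightarrow>
    norm (hbvm_path k s f h y0 Y 1 - y h) \<le> C * \<bar>h\<bar> ^ (2 * r + 3)))"
proof -
  have "s \<le> k" using s by simp
  obtain f0 L B where L: "bounded_linear L" and B: "bounded_bilinear B"
    and f_eq: "f = (\<lambda>y. f0 + L y + B y y)"
    using f by (auto simp: quadratic_map_def)
  interpret L: bounded_linear L by fact
  interpret B: bounded_bilinear B by fact
  obtain b where b: "0 \<le> b" "\<And>x y. norm (B x y) \<le> norm x * norm y * b" using B.nonneg_bounded by auto
  obtain v \<delta> Cv where \<delta>: "0 < \<delta>"
    and v: "\<And>t. t \<in> I \<Longrightarrow> \<bar>t\<bar> < \<delta> \<Longrightarrow> norm (y t - (\<Sum>i\<le>r. t ^ i *\<^sub>R v i)) \<le> Cv * \<bar>t\<bar> ^ Suc r"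
    using ivp_solution_expansion[OF f y, of r] by auto
  obtain C h1 where C: "0 \<le> C" and h1: "0 < h1" and err: "\<And>h Y c. h \<in> I \<Longrightarrow> \<bar>h\<bar> < h1 \<Longrightarrow>
      rk_stages k (hbvm_A k s) f h y0 Y \<Longrightarrow> \<forall>i<k. Y i \<in> cball y0 1 \<Longrightarrow> c \<in> {0..1} \<Longrightarrow>
      norm (hbvm_path k s f h y0 Y c - y (h * c)) \<le> C * \<bar>h\<bar> ^ (r + 2)"
    using hbvm_path_error[OF f s(1) \<open>s \<le> k\<close> y] by blast
  define A where "A = (\<lambda>j x. (if j = 0 then L x else 0) + (B (v j) x + B x (v j)))"
  have A: "bounded_linear (A j)" for j
  proof -
    have "bounded_linear (\<lambda>x. if j = 0 then L x else 0)" by (cases "j = 0") (simp_all add: L bounded_linear_zero)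
    then show ?thesis unfolding A_def
      by (intro bounded_linear_add B.bounded_linear_left B.bounded_linear_right)
  qed
  have "\<exists>K. \<forall>x. norm (A j x) \<le> norm x * K" for j using bounded_linear.bounded[OF A] by auto
  then obtain aj where aj: "\<And>j x. norm (A j x) \<le> norm x * aj j" by metis
  define a where "a = (\<Sum>j\<le>r. \<bar>aj j\<bar>)"
  have "0 \<le> a" by (simp add: a_def sum_nonneg)
  have a: "norm (A j x) \<le> a * norm x" if "j \<le> r" for j x
  proof -
    have "aj j \<le> a" unfolding a_def using that member_le_sum[of j "{..r}" "\<lambda>j. \<bar>aj j\<bar>"] by force
    then show ?thesis using aj[of j x] mult_left_mono[of "aj j" a "norm x"] by (simp add: mult.commute)
  qed
  \<comment> \<open>One constant that dominates both the bound on \<open>E\<close> and the one on \<open>\<rho>\<close>.\<close>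
  define C2 where "C2 = C + (2 * (\<bar>Cv\<bar> * C) * b + C * C * b)"
  have C2: "0 \<le> C2" "C \<le> C2" "2 * (\<bar>Cv\<bar> * C) * b + C * C * b \<le> C2" using C b(1) by (auto simp: C2_def)
  obtain K where K: "0 \<le> K" and boot: "\<And>\<eta> \<epsilon> (m :: nat \<Rightarrow> real) n. 0 \<le> \<eta> \<Longrightarrow> \<eta> \<le> 1 \<Longrightarrow> 0 \<le> \<epsilon> \<Longrightarrow>
    \<forall>i. m i \<le> C2 * \<eta> ^ (r + 2) \<Longrightarrow> \<forall>i<r. m i \<le> \<epsilon> + n (Suc i) \<Longrightarrow> \<epsilon> \<le> n 0 \<Longrightarrow>
    \<forall>i\<le>r. n i \<le> \<eta> * ((\<Sum>j\<le>r. \<eta> ^ j * (a * m (i + j))) + C2 * \<eta> ^ (2 * r + 3)) \<Longrightarrow>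
    \<epsilon> \<le> K * (\<eta> * \<epsilon> + \<eta> ^ (2 * r + 3))"
    using moment_bootstrap[OF \<open>0 \<le> a\<close> C2(1), of r] by blast
  \<comment> \<open>The last entry makes \<open>|h| K \<le> 1/2\<close>, so that \<open>|E(1)|\<close> can be absorbed at the end.\<close>
  define h2 where "h2 = Min {\<delta>, h1, 1, 1 / (2 * (K + 1))}"
  have "norm (hbvm_path k s f h y0 Y 1 - y h) \<le> 2 * K * \<bar>h\<bar> ^ (2 * r + 3)"
    if h: "h \<in> I" "\<bar>h\<bar> < h2" and Y: "rk_stages k (hbvm_A k s) f h y0 Y" "\<forall>i<k. Y i \<in> cball y0 1" for h Y
  proof -
    have hs: "\<bar>h\<bar> < \<delta>" "\<bar>h\<bar> < h1" "\<bar>h\<bar> \<le> 1" "\<bar>h\<bar> * K \<le> 1 / 2"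
    proof -
      have "\<bar>h\<bar> * (2 * (K + 1)) < 1" using h(2) K unfolding h2_def by (simp add: pos_less_divide_eq)
      then show "\<bar>h\<bar> * K \<le> 1 / 2" by (simp add: algebra_simps)
    qed (use h(2) in \<open>auto simp: h2_def\<close>)
    define \<sigma> where "\<sigma> = hbvm_path k s f h y0 Y"
    define z where "z = (\<lambda>c. y (h * c))"
    define E where "E = (\<lambda>c. \<sigma> c - z c)"
    define proj where "proj = discrete_projection k s (\<lambda>j. f (Y j))"
    define E' where "E' = (\<lambda>c. h *\<^sub>R (proj c - f (z c)))"
    define M where "M = (\<lambda>i. integral {0..1} (\<lambda>c. c ^ i *\<^sub>R E c))"
    define N where "N = (\<lambda>i. integral {0..1} (\<lambda>c. c ^ i *\<^sub>R E' c))"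
    define R where "R = (\<lambda>c. z c - (\<Sum>i\<le>r. (h * c) ^ i *\<^sub>R v i))"
    define \<rho> where "\<rho> = (\<lambda>c. B (R c) (E c) + B (E c) (R c) + B (E c) (E c))"
    have E_bound: "norm (E c) \<le> C * \<bar>h\<bar> ^ (r + 2)" if "c \<in> {0..1}" for c
      using err[OF h(1) hs(2) Y that] by (simp add: E_def \<sigma>_def z_def)
    have R_bound: "norm (R c) \<le> \<bar>Cv\<bar> * \<bar>h\<bar> ^ Suc r" if "c \<in> {0..1}" for c
    proof -
      have hc: "\<bar>h * c\<bar> \<le> \<bar>h\<bar>" using that by (auto simp: abs_mult intro: mult_left_le)
      then have "norm (R c) \<le> Cv * \<bar>h * c\<bar> ^ Suc r"
        unfolding R_def z_def using ivp_solution_scaled(1)[OF y h(1) that] hs(1) by (intro v) auto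
      also have "\<dots> \<le> \<bar>Cv\<bar> * \<bar>h\<bar> ^ Suc r" using hc by (intro mult_mono power_mono) auto
      finally show ?thesis .
    qed
    have \<rho>_bound: "norm (\<rho> c) \<le> C2 * \<bar>h\<bar> ^ (2 * r + 3)" if "c \<in> {0..1}" for c
    proof -
      have BB: "norm (B x x') \<le> p * p' * b" if "norm x \<le> p" "norm x' \<le> p'" for x x' p p'
        using b(2)[of x x'] mult_right_mono[OF mult_mono[OF that order_trans[OF norm_ge_zero that(1)] norm_ge_zero] b(1)]
        by linarith
      have "norm (\<rho> c) \<le> (\<bar>Cv\<bar> * \<bar>h\<bar> ^ Suc r) * (C * \<bar>h\<bar> ^ (r + 2)) * b
          + (C * \<bar>h\<bar> ^ (r + 2)) * (\<bar>Cv\<bar> * \<bar>h\<bar> ^ Suc r) * b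
          + (C * \<bar>h\<bar> ^ (r + 2)) * (C * \<bar>h\<bar> ^ (r + 2)) * b"
        unfolding \<rho>_def using E_bound[OF that] R_bound[OF that]
        by (intro norm_triangle_mono BB)
      also have "\<dots> = 2 * (\<bar>Cv\<bar> * C) * b * \<bar>h\<bar> ^ (2 * r + 3) + C * C * b * (\<bar>h\<bar> ^ (2 * r + 3) * \<bar>h\<bar>)"
      proof -
        have "\<bar>h\<bar> ^ Suc r * \<bar>h\<bar> ^ (r + 2) = \<bar>h\<bar> ^ (2 * r + 3)"
          "\<bar>h\<bar> ^ (r + 2) * \<bar>h\<bar> ^ (r + 2) = \<bar>h\<bar> ^ (2 * r + 3) * \<bar>h\<bar>"
          by (simp_all add: mult_2 numeral_eq_Suc power_add)
        moreover have "V * p * (C * q) * b + C * q * (V * p) * b + C * q * (C * q) * b =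
            2 * (V * C) * b * (p * q) + C * C * b * (q * q)" for V p q :: real by algebra
        ultimately show ?thesis by (simp only:)
      qed
      also have "\<dots> \<le> 2 * (\<bar>Cv\<bar> * C) * b * \<bar>h\<bar> ^ (2 * r + 3) + C * C * b * \<bar>h\<bar> ^ (2 * r + 3)"
        using C b(1) hs(3) by (intro add_left_mono mult_left_mono mult_left_le) auto
      also have "\<dots> \<le> C2 * \<bar>h\<bar> ^ (2 * r + 3)"
        using C2(3) by (simp add: mult_right_mono flip: distrib_right)
      finally show ?thesis .
    qed
    have z: "continuous_on {0..1} z"
      unfolding z_def by (rule continuous_on_vector_derivative[OF ivp_solution_scaled(2)[OF y h(1)]])
    have \<sigma>: "continuous_on {0..1} \<sigma>" unfolding \<sigma>_def
      by (rule vector_poly_continuous[OF vector_poly_hbvm_path])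
    have E: "continuous_on {0..1} E" unfolding E_def by (intro continuous_intros z \<sigma>)
    have "continuous_on {0..1} (\<lambda>c. f (z c))"
      using continuous_on_compose2[OF quadratic_map_continuous[OF f] z subset_UNIV] .
    then have E': "continuous_on {0..1} E'" unfolding E'_def proj_def
      by (intro continuous_intros vector_poly_continuous[OF vector_poly_discrete_projection])
    have R: "continuous_on {0..1} R" unfolding R_def by (intro continuous_intros z)
    have \<rho>: "continuous_on {0..1} \<rho>" unfolding \<rho>_def by (intro continuous_intros B.continuous_on E R)
    have weighted: "continuous_on {0..1} (\<lambda>c :: real. c ^ i *\<^sub>R g c)" if "continuous_on {0..1} g" for i and g :: "real \<Rightarrow> 'a"
      using that by (intro continuous_intros)
    have weighted_bound: "norm (integral {0..1} (\<lambda>c :: real. c ^ i *\<^sub>R g c)) \<le> G"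
      if "continuous_on {0..1} g" "\<And>c. c \<in> {0..1} \<Longrightarrow> norm (g c) \<le> G" for i G and g :: "real \<Rightarrow> 'a"
    proof -
      have "norm (integral {0..1} (\<lambda>c :: real. c ^ i *\<^sub>R g c)) \<le> G * (1 - 0)"
      proof (rule integral_bound)
        fix c :: real assume c: "c \<in> {0..1}"
        have "norm (c ^ i *\<^sub>R g c) \<le> 1 * norm (g c)"
          unfolding norm_scaleR using c by (intro mult_right_mono) (auto intro: power_le_one simp: power_abs)
        then show "norm (c ^ i *\<^sub>R g c) \<le> G" using that(2)[OF c] by simp
      qed (use weighted[OF that(1)] in auto)
      then show ?thesis by simp
    qed
    have E_deriv: "(E has_vector_derivative E' c) (at c within {0..1})" if "c \<in> {0..1}" for c
      unfolding E_def E'_def \<sigma>_def z_def proj_def scaleR_diff_right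
      by (intro has_vector_derivative_diff hbvm_path_derivative ivp_solution_scaled(2)[OF y h(1) that])
    have E0: "E 0 = 0" using y by (simp add: E_def z_def \<sigma>_def hbvm_path_0 ivp_solution_def)
    have N0: "E 1 = N 0"
    proof -
      have "(E' has_integral E 1 - E 0) {0..1}"
        by (rule fundamental_theorem_of_calculus) (use E_deriv in auto)
      then show ?thesis by (simp add: N_def E0 integral_unique)
    qed
    have N_Suc: "E 1 = real (Suc i) *\<^sub>R M i + N (Suc i)" for i
    proof -
      have "((\<lambda>c. c ^ Suc i *\<^sub>R E' c + (real (Suc i) * c ^ i) *\<^sub>R E c) has_integral
          (1 ^ Suc i *\<^sub>R E 1 - 0 ^ Suc i *\<^sub>R E 0)) {0..1}"
      proof (rule fundamental_theorem_of_calculus)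
        fix c :: real assume "c \<in> {0..1}"
        moreover have "((\<lambda>c. c ^ Suc i) has_real_derivative real (Suc i) * c ^ i) (at c within {0..1})"
          by (auto intro!: derivative_eq_intros simp del: power_Suc of_nat_Suc)
        ultimately show "((\<lambda>c. c ^ Suc i *\<^sub>R E c) has_vector_derivative
            c ^ Suc i *\<^sub>R E' c + (real (Suc i) * c ^ i) *\<^sub>R E c) (at c within {0..1})"
          by (intro has_vector_derivative_scaleR E_deriv)
      qed simp
      moreover have "((\<lambda>c. c ^ Suc i *\<^sub>R E' c + real (Suc i) *\<^sub>R (c ^ i *\<^sub>R E c)) has_integral
          (N (Suc i) + real (Suc i) *\<^sub>R M i)) {0..1}"
        unfolding N_def M_def
        by (intro has_integral_add has_integral_cmul integrable_integral integrable_continuous_real weighted E E')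
      ultimately have "1 ^ Suc i *\<^sub>R E 1 - 0 ^ Suc i *\<^sub>R E 0 = N (Suc i) + real (Suc i) *\<^sub>R M i"
        unfolding scaleR_scaleR by (rule has_integral_unique)
      then show ?thesis by (simp add: add.commute)
    qed
    have N_bound: "norm (N i) \<le> \<bar>h\<bar> * ((\<Sum>j\<le>r. \<bar>h\<bar> ^ j * (a * norm (M (i + j)))) + C2 * \<bar>h\<bar> ^ (2 * r + 3))"
      if "i \<le> r" for i
    proof -
      have node: "\<And>j. j < k \<Longrightarrow> Y j = \<sigma> (gl_node k j)"
        using hbvm_path_node[OF Y(1)] by (simp add: \<sigma>_def)
      have proj: "proj = discrete_projection k s (\<lambda>j. f (\<sigma> (gl_node k j)))"
        unfolding proj_def discrete_projection_def legendre_moment_def using node by auto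
      have f\<sigma>: "vector_poly (2 * s) (\<lambda>c. f (\<sigma> c))"
        unfolding \<sigma>_def by (rule vector_poly_quadratic_map[OF f vector_poly_hbvm_path])
      \<comment> \<open>In this proof, the only use of exactness up to degree \<open>3s - 1\<close>.\<close>
      have defect: "((\<lambda>c. c ^ i *\<^sub>R (proj c - f (\<sigma> c))) has_integral 0) {0..1}"
        unfolding proj by (rule projection_defect_orthogonal[OF f\<sigma>]) (use that s \<open>s \<le> k\<close> in auto)
      have split: "c ^ i *\<^sub>R E' c = h *\<^sub>R (c ^ i *\<^sub>R (proj c - f (\<sigma> c)) +
          ((\<Sum>j\<le>r. h ^ j *\<^sub>R A j (c ^ (i + j) *\<^sub>R E c)) + c ^ i *\<^sub>R \<rho> c))" for c
      proof -
        have \<sigma>_eq: "\<sigma> c = z c + E c" by (simp add: E_def)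
        have "f (\<sigma> c) - f (z c) = L (E c) + B (z c) (E c) + B (E c) (z c) + B (E c) (E c)"
          unfolding \<sigma>_eq f_eq by (simp add: L.add B.add_left B.add_right)
        also have "\<dots> = L (E c) + (B (z c - R c) (E c) + B (E c) (z c - R c)) + \<rho> c"
          by (simp add: \<rho>_def B.diff_left B.diff_right)
        also have "z c - R c = (\<Sum>j\<le>r. (h * c) ^ j *\<^sub>R v j)" by (simp add: R_def)
        also have "L (E c) + (B (\<Sum>j\<le>r. (h * c) ^ j *\<^sub>R v j) (E c) + B (E c) (\<Sum>j\<le>r. (h * c) ^ j *\<^sub>R v j)) =
            (\<Sum>j\<le>r. (h * c) ^ j *\<^sub>R A j (E c))"
        proof -
          have "(\<Sum>j\<le>r. (h * c) ^ j *\<^sub>R (if j = 0 then L (E c) else 0)) = L (E c)"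
          proof -
            have "(\<Sum>j\<le>r. (h * c) ^ j *\<^sub>R (if j = 0 then L (E c) else 0)) =
                (\<Sum>j\<le>r. if j = 0 then L (E c) else 0)" by (intro sum.cong) auto
            then show ?thesis by simp
          qed
          then show ?thesis
            unfolding A_def scaleR_right_distrib sum.distrib
            by (simp add: B.sum_left B.sum_right B.scaleR_left B.scaleR_right)
        qed
        finally have "f (\<sigma> c) - f (z c) = (\<Sum>j\<le>r. (h * c) ^ j *\<^sub>R A j (E c)) + \<rho> c" .
        then have "proj c - f (z c) = (proj c - f (\<sigma> c)) + ((\<Sum>j\<le>r. (h * c) ^ j *\<^sub>R A j (E c)) + \<rho> c)"
          by (simp add: algebra_simps)
        moreover have "c ^ i *\<^sub>R (\<Sum>j\<le>r. (h * c) ^ j *\<^sub>R A j (E c)) =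
            (\<Sum>j\<le>r. h ^ j *\<^sub>R A j (c ^ (i + j) *\<^sub>R E c))"
          unfolding scaleR_sum_right linear_scale[OF bounded_linear.linear[OF A]]
          by (simp add: power_mult_distrib power_add mult_ac)
        ultimately show ?thesis unfolding E'_def
          by (simp only: scaleR_left_commute[of _ h] scaleR_right_distrib)
      qed
      have "((\<lambda>c. A j (c ^ (i + j) *\<^sub>R E c)) has_integral A j (M (i + j))) {0..1}" for j
        using has_integral_linear[OF integrable_integral[OF integrable_continuous_real[OF weighted[OF E]]] A]
        by (simp add: o_def M_def)
      moreover have "((\<lambda>c. c ^ i *\<^sub>R \<rho> c) has_integral integral {0..1} (\<lambda>c. c ^ i *\<^sub>R \<rho> c)) {0..1}"
        by (intro integrable_integral integrable_continuous_real weighted \<rho>)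
      ultimately have "((\<lambda>c. c ^ i *\<^sub>R E' c) has_integral h *\<^sub>R (0 + ((\<Sum>j\<le>r. h ^ j *\<^sub>R A j (M (i + j)))
          + integral {0..1} (\<lambda>c. c ^ i *\<^sub>R \<rho> c)))) {0..1}"
        unfolding split by (intro has_integral_cmul has_integral_add defect has_integral_sum) auto
      then have "N i = h *\<^sub>R ((\<Sum>j\<le>r. h ^ j *\<^sub>R A j (M (i + j))) + integral {0..1} (\<lambda>c. c ^ i *\<^sub>R \<rho> c))"
        unfolding N_def by (simp add: integral_unique)
      moreover have "norm ((\<Sum>j\<le>r. h ^ j *\<^sub>R A j (M (i + j))) + integral {0..1} (\<lambda>c. c ^ i *\<^sub>R \<rho> c)) \<le>
          (\<Sum>j\<le>r. \<bar>h\<bar> ^ j * (a * norm (M (i + j)))) + C2 * \<bar>h\<bar> ^ (2 * r + 3)"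
        by (intro norm_triangle_mono sum_norm_le weighted_bound \<rho> \<rho>_bound)
           (auto simp: power_abs intro!: mult_left_mono a)
      ultimately show ?thesis by (simp add: mult_left_mono)
    qed
    have "norm (E 1) \<le> K * (\<bar>h\<bar> * norm (E 1) + \<bar>h\<bar> ^ (2 * r + 3))"
    proof (rule boot[where m = "\<lambda>i. norm (M i)" and n = "\<lambda>i. norm (N i)"])
      show "\<forall>i. norm (M i) \<le> C2 * \<bar>h\<bar> ^ (r + 2)"
        unfolding M_def using E_bound C2(2)
        by (intro allI weighted_bound E) (meson order_trans mult_right_mono zero_le_power abs_ge_zero)
      show "\<forall>i<r. norm (M i) \<le> norm (E 1) + norm (N (Suc i))"
      proof (intro allI impI)
        fix i
        have "norm (M i) \<le> real (Suc i) * norm (M i)" by (simp add: algebra_simps)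
        also have "\<dots> = norm (E 1 - N (Suc i))" using N_Suc[of i] by simp
        also have "\<dots> \<le> norm (E 1) + norm (N (Suc i))" by (rule norm_triangle_ineq4)
        finally show "norm (M i) \<le> norm (E 1) + norm (N (Suc i))" .
      qed
    qed (use hs(3) N0 N_bound in auto)
    also have "\<dots> = \<bar>h\<bar> * K * norm (E 1) + K * \<bar>h\<bar> ^ (2 * r + 3)" by (simp add: algebra_simps)
    also have "\<dots> \<le> 1 / 2 * norm (E 1) + K * \<bar>h\<bar> ^ (2 * r + 3)"
      using hs(4) by (intro add_right_mono mult_right_mono) auto
    finally show ?thesis by (simp add: E_def \<sigma>_def z_def)
  qed
  moreover have "0 < h2" using \<delta> h1 K by (simp add: h2_def)
  ultimately show ?thesis by blast
qed

text \<open>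
  Once \<open>h\<close> is so small that all stages lie within distance \<open>1\<close> of \<open>y0\<close>, the end point estimate applies to
  them; its constant belongs to the given solution, and does not depend on the step size.
\<close>

theorem hbvm_order_quadratic:
  fixes f :: "'a::euclidean_space \<Rightarrow> 'a"
  assumes f: "quadratic_map f" and s: "1 \<le> s" "3 * s \<le> 2 * k"
  shows "rk_has_order k (hbvm_A k s) (hbvm_b k) f (2 * s)"
  unfolding rk_has_order_def
proof
  fix y0
  obtain r where r: "s = Suc r" using s(1) by (cases s) auto
  obtain K where "0 \<le> K" "\<And>x y. x \<in> cball y0 1 \<Longrightarrow> y \<in> cball y0 1 \<Longrightarrow> norm (f x - f y) \<le> K * norm (x - y)"
    using quadratic_map_lipschitz[OF f, of y0] by auto
  from rk_stage_branch_exists[OF this, where k = k and A = "hbvm_A k s"]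
  obtain Y where Y: "rk_stage_branch k (hbvm_A k s) f y0 Y" by blast
  have "(\<lambda>h. norm (rk_update k (hbvm_b k) f h y0 (Y h) - y h)) \<in> O[at 0 within I](\<lambda>h. h ^ (2 * s + 1))"
    if y: "ivp_solution f y0 I y" for I y
  proof -
    obtain C h1 where "0 < h1" and err: "\<And>h Y. h \<in> I \<Longrightarrow> \<bar>h\<bar> < h1 \<Longrightarrow>
        rk_stages k (hbvm_A k s) f h y0 Y \<Longrightarrow> \<forall>i<k. Y i \<in> cball y0 1 \<Longrightarrow>
        norm (hbvm_path k s f h y0 Y 1 - y h) \<le> C * \<bar>h\<bar> ^ (2 * r + 3)"
      using hbvm_path_endpoint_error[OF f r s(2) y] by blast
    obtain h0 where "0 < h0" and stages: "\<And>h. \<bar>h\<bar> < h0 \<Longrightarrow> rk_stages k (hbvm_A k s) f h y0 (Y h)"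
      using Y unfolding rk_stage_branch_def by blast
    have "\<forall>\<^sub>F h in at 0 within I. h \<in> I \<and> \<bar>h\<bar> < h0 \<and> \<bar>h\<bar> < h1"
      unfolding eventually_at using \<open>0 < h0\<close> \<open>0 < h1\<close>
      by (intro exI[of _ "min h0 h1"]) (auto simp: dist_norm)
    moreover have "\<forall>\<^sub>F h in at 0 within I. \<forall>i\<in>{..<k}. dist (Y h i) y0 < 1"
    proof (rule eventually_ball_finite)
      show "\<forall>i\<in>{..<k}. \<forall>\<^sub>F h in at 0 within I. dist (Y h i) y0 < 1"
        using Y unfolding rk_stage_branch_def
        by (auto intro!: tendstoD[OF tendsto_within_subset[of _ _ _ UNIV]])
    qed simp
    ultimately have "\<forall>\<^sub>F h in at 0 within I. norm (norm (rk_update k (hbvm_b k) f h y0 (Y h) - y h)) \<le>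
        C * norm (h ^ (2 * s + 1))"
    proof eventually_elim
      case (elim h)
      then have "norm (hbvm_path k s f h y0 (Y h) 1 - y h) \<le> C * \<bar>h\<bar> ^ (2 * r + 3)"
        by (intro err stages) (auto simp: dist_commute intro: less_imp_le)
      moreover have "2 * s + 1 = 2 * r + 3" using r by simp
      ultimately show ?case by (simp only: hbvm_path_1[OF s(1)] real_norm_def power_abs abs_norm_cancel)
    qed
    then show ?thesis by (rule bigoI)
  qed
  then show "\<exists>Y. rk_stage_branch k (hbvm_A k s) f y0 Y \<and> (\<forall>I y. ivp_solution f y0 I y \<longrightarrow>
      (\<lambda>h. norm (rk_update k (hbvm_b k) f h y0 (Y h) - y h)) \<in> O[at 0 within I](\<lambda>h. h ^ (2 * s + 1)))"
    using Y by blast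
qed

section \<open>The Hamiltonian problem\<close>

lemma sum_UNIV_prod: "(\<Sum>i\<in>UNIV. g i) = (\<Sum>x\<in>UNIV. \<Sum>y\<in>UNIV. g (x, y))"
  for g :: "'x::finite \<times> 'y::finite \<Rightarrow> real"
  by (simp add: sum.cartesian_product flip: UNIV_Times_UNIV)

lemma transpose_kronecker: "transpose (A \<otimes>\<^sub>K B) = transpose A \<otimes>\<^sub>K transpose B"
  by (simp add: kronecker_def transpose_def)

lemma kronecker_uminus_right: "A \<otimes>\<^sub>K (- B) = - (A \<otimes>\<^sub>K B)"
  by (simp add: kronecker_def vec_eq_iff)

lemma transpose_Dmat: "transpose (Dmat a b) = Dmat a b"
  by (auto simp: Dmat_def transpose_def vec_eq_iff)

lemma inner_matrix_vector_mult_left: "(A *v x) \<bullet> y = x \<bullet> (transpose A *v y)"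
  for A :: "real^'n^'m"
  by (metis dot_lmul_matrix inner_commute vector_transpose_matrix transpose_transpose)

text \<open>
  Of the three Kronecker factors two are symmetric and one is skew-symmetric.
\<close>

lemma skew_structure_matrix:
  fixes x :: "real^(2 \<times> 'n::{finite,linorder} \<times> 2)"
  shows "x \<bullet> ((absJ2 \<otimes>\<^sub>K Dmat a b \<otimes>\<^sub>K transpose J2) *v x) = 0"
proof -
  define S :: "real^(2 \<times> 'n \<times> 2)^(2 \<times> 'n \<times> 2)" where "S = absJ2 \<otimes>\<^sub>K Dmat a b \<otimes>\<^sub>K transpose J2"
  have absJ2: "transpose absJ2 = absJ2" and J2: "transpose (transpose J2) = - transpose J2"
    by (simp_all add: absJ2_def J2_def transpose_def vec_eq_iff forall_2)
  have "transpose S = - S"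
    unfolding S_def transpose_kronecker transpose_Dmat absJ2 J2 kronecker_uminus_right ..
  have "x \<bullet> (S *v x) = (S *v x) \<bullet> x" by (rule inner_commute)
  also have "\<dots> = x \<bullet> (transpose S *v x)" by (rule inner_matrix_vector_mult_left)
  also have "\<dots> = - (x \<bullet> (S *v x))"
    unfolding \<open>transpose S = - S\<close>
    by (simp add: matrix_vector_mult_def inner_vec_def sum_negf)
  finally show ?thesis by (simp add: S_def)
qed

text \<open>
  The factor \<open>|J\<^sub>2|\<close> interchanges the blocks of \<open>q\<close> and \<open>p\<close>.
\<close>

lemma absJ2_kronecker_join_qp:
  "(absJ2 \<otimes>\<^sub>K A) *v join_qp q p = join_qp (A *v p) (A *v q)"
proof -
  have "((absJ2 \<otimes>\<^sub>K A) *v join_qp q p) $ (i, j) = join_qp (A *v p) (A *v q) $ (i, j)" for i j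
    using exhaust_2[of i]
    by (auto simp: matrix_vector_mult_def kronecker_def join_qp_def sum_UNIV_prod sum_2 absJ2_def)
  then show ?thesis by (simp add: vec_eq_iff split_paired_all)
qed

lemma linear_q_part: "linear (q_part :: real^(2 \<times> 'm::finite) \<Rightarrow> real^'m)"
  and linear_p_part: "linear (p_part :: real^(2 \<times> 'm::finite) \<Rightarrow> real^'m)"
  by (auto simp: q_part_def p_part_def linear_iff vec_eq_iff)

lemma inner_join_qp: "join_qp q p \<bullet> y = q \<bullet> q_part y + p \<bullet> p_part y"
  by (simp add: inner_vec_def sum_UNIV_prod[where 'x = 2] sum_2 join_qp_def q_part_def p_part_def)

lemma gradient_eqI:
  fixes F :: "'a::euclidean_space \<Rightarrow> real"
  assumes "GDERIV F y :> g"
  shows "gradient F y = g"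
  unfolding gradient_def
proof (rule the_equality)
  fix g' assume "GDERIV F y :> g'"
  then have "(\<lambda>h. h \<bullet> g') = (\<lambda>h. h \<bullet> g)"
    using assms unfolding gderiv_def by (rule has_derivative_unique)
  then show "g' = g" by (metis vector_eq_ldot)
qed (fact assms)

lemma continuous_on_omega: "continuous_on S (omega a b)"
proof -
  have "continuous_on S (\<lambda>x. if P then sin_basis a b j x else cos_basis a b j x)" for P j
    unfolding cos_basis_def sin_basis_def divide_inverse by (cases P) (auto intro!: continuous_intros)
  then show ?thesis unfolding omega_def[abs_def] by (intro continuous_on_vec_lambda)
qed

text \<open>
  Symmetry makes \<open>M q\<close> the gradient of half of the quadratic form \<open>q \<bullet> M q\<close>.
\<close>

lemma Dmat_squared_symmetric:
  "q \<bullet> (((Dmat a b ** Dmat a b) \<otimes>\<^sub>K mat 1) *v q') = (((Dmat a b ** Dmat a b) \<otimes>\<^sub>K mat 1) *v q) \<bullet> q'"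
  unfolding inner_matrix_vector_mult_left
  by (simp add: transpose_kronecker matrix_transpose_mul transpose_Dmat)

text \<open>
  The coefficients of the expansion of \<open>\<integral> \<omega> (u\<^sub>0 + \<omega> \<bullet> q)\<^sup>2\<close> in powers of \<open>q\<close>, up to powers of \<open>u\<^sub>0\<close> and binomial
  coefficients.
\<close>

definition potential_vector :: "real \<Rightarrow> real \<Rightarrow> real^('n::{finite,linorder} \<times> 2)" where
  "potential_vector a b = integral {a..b} (omega a b)"

definition potential_linear :: "real \<Rightarrow> real \<Rightarrow> real^('n \<times> 2) \<Rightarrow> real^('n::{finite,linorder} \<times> 2)" where
  "potential_linear a b q = integral {a..b} (\<lambda>x. (omega a b x \<bullet> q) *\<^sub>R omega a b x)"

definition potential_bilinear ::
    "real \<Rightarrow> real \<Rightarrow> real^('n \<times> 2) \<Rightarrow> real^('n \<times> 2) \<Rightarrow> real^('n::{finite,linorder} \<times> 2)" where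
  "potential_bilinear a b q q' =
     integral {a..b} (\<lambda>x. ((omega a b x \<bullet> q) * (omega a b x \<bullet> q')) *\<^sub>R omega a b x)"

lemma omega_integrable:
  "omega a b integrable_on {a..b}"
  "(\<lambda>x. (omega a b x \<bullet> q) *\<^sub>R omega a b x) integrable_on {a..b}"
  "(\<lambda>x. ((omega a b x \<bullet> q) * (omega a b x \<bullet> q')) *\<^sub>R omega a b x) integrable_on {a..b}"
  by (intro integrable_continuous_real continuous_intros continuous_on_omega)+

lemma bilinear_potential_bilinear: "bilinear (potential_bilinear a b)"
proof -
  have lin: "linear (potential_bilinear a b q)" for q
  proof (rule linearI)
    show "potential_bilinear a b q (x + y) = potential_bilinear a b q x + potential_bilinear a b q y" for x y
      by (simp add: potential_bilinear_def inner_add_right distrib_left scaleR_add_left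
          integral_add omega_integrable)
    show "potential_bilinear a b q (r *\<^sub>R x) = r *\<^sub>R potential_bilinear a b q x" for r x
    proof -
      have eq: "((omega a b t \<bullet> q) * (omega a b t \<bullet> (r *\<^sub>R x))) *\<^sub>R omega a b t =
          r *\<^sub>R (((omega a b t \<bullet> q) * (omega a b t \<bullet> x)) *\<^sub>R omega a b t)" for t
        by (simp add: mult.left_commute)
      show ?thesis unfolding potential_bilinear_def eq by (rule integral_cmul)
    qed
  qed
  have sym: "(\<lambda>q. potential_bilinear a b q q') = potential_bilinear a b q'" for q'
    by (simp add: potential_bilinear_def mult.commute fun_eq_iff)
  have "linear (\<lambda>q. potential_bilinear a b q q')" for q'
    by (subst sym) (rule lin)
  with lin show ?thesis unfolding bilinear_def by blast
qed

lemma linear_potential_linear: "linear (potential_linear a b)"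
proof (rule linearI)
  show "potential_linear a b (x + y) = potential_linear a b x + potential_linear a b y" for x y
    by (simp add: potential_linear_def inner_add_right scaleR_add_left integral_add omega_integrable)
  show "potential_linear a b (r *\<^sub>R x) = r *\<^sub>R potential_linear a b x" for r x
  proof -
    have eq: "(omega a b t \<bullet> (r *\<^sub>R x)) *\<^sub>R omega a b t = r *\<^sub>R ((omega a b t \<bullet> x) *\<^sub>R omega a b t)" for t
      by simp
    show ?thesis unfolding potential_linear_def eq by (rule integral_cmul)
  qed
qed

lemma potential_gradient_expand:
  "integral {a..b} (\<lambda>x. (u0 + omega a b x \<bullet> q)\<^sup>2 *\<^sub>R omega a b x) =
    u0\<^sup>2 *\<^sub>R potential_vector a b + (2 * u0) *\<^sub>R potential_linear a b q + potential_bilinear a b q q"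
proof -
  have eq: "(u0 + omega a b x \<bullet> q)\<^sup>2 *\<^sub>R omega a b x = u0\<^sup>2 *\<^sub>R omega a b x +
      (2 * u0) *\<^sub>R ((omega a b x \<bullet> q) *\<^sub>R omega a b x) +
      ((omega a b x \<bullet> q) * (omega a b x \<bullet> q)) *\<^sub>R omega a b x" for x
    by (simp add: power2_eq_square algebra_simps flip: scaleR_add_left)
  show ?thesis
    unfolding eq potential_vector_def potential_linear_def potential_bilinear_def
    by (intro integral_unique has_integral_add has_integral_cmul integrable_integral omega_integrable)
qed

text \<open>
  Expanded in powers of \<open>q\<close>, the integral is a cubic polynomial whose coefficients are integrals of products of the
  basis functions, so it can be differentiated term by term.  The quadratic and the cubic term come from a symmetric
  bilinear and a symmetric trilinear form, and so the terms of the derivative combine into the stated gradient.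
\<close>

lemma potential_has_derivative:
  fixes q :: "real^('n::{finite,linorder} \<times> 2)"
  shows "((\<lambda>q. integral {a..b} (\<lambda>x. (u0 + omega a b x \<bullet> q) ^ 3)) has_derivative
    (\<lambda>d. 3 * (d \<bullet> integral {a..b} (\<lambda>x. (u0 + omega a b x \<bullet> q)\<^sup>2 *\<^sub>R omega a b x)))) (at q)"
proof -
  let ?c = "potential_vector a b" and ?L = "potential_linear a b" and ?B = "potential_bilinear a b"
  have pull: "((\<lambda>x. g x \<bullet> q) has_integral (integral {a..b} g \<bullet> q)) {a..b}"
    if "g integrable_on {a..b}" for g :: "real \<Rightarrow> real^('n \<times> 2)" and q
    using has_integral_linear[OF integrable_integral[OF that] bounded_linear_inner_left[of q]]
    by (simp add: o_def)
  have expand: "integral {a..b} (\<lambda>x. (u0 + omega a b x \<bullet> q) ^ 3) = u0 ^ 3 * integral {a..b} (\<lambda>x. 1) +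
      3 * u0\<^sup>2 * (?c \<bullet> q) + 3 * u0 * (?L q \<bullet> q) + ?B q q \<bullet> q" for q :: "real^('n \<times> 2)"
  proof -
    have eq: "(u0 + omega a b x \<bullet> q) ^ 3 = u0 ^ 3 * 1 + 3 * u0\<^sup>2 * (omega a b x \<bullet> q) +
        3 * u0 * (((omega a b x \<bullet> q) *\<^sub>R omega a b x) \<bullet> q) +
        (((omega a b x \<bullet> q) * (omega a b x \<bullet> q)) *\<^sub>R omega a b x) \<bullet> q" for x
      by (simp add: power2_eq_square power3_eq_cube algebra_simps)
    show ?thesis
      unfolding eq potential_vector_def potential_linear_def potential_bilinear_def
      by (intro integral_unique has_integral_add has_integral_mult_right pull omega_integrable
          integrable_integral[OF integrable_const_ivl])
  qed
  have deriv: "((\<lambda>q. u0 ^ 3 * integral {a..b} (\<lambda>x. 1 :: real) + 3 * u0\<^sup>2 * (?c \<bullet> q) + 3 * u0 * (?L q \<bullet> q) + ?B q q \<bullet> q)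
    has_derivative (\<lambda>d. 0 + 3 * u0\<^sup>2 * (?c \<bullet> d) + 3 * u0 * (?L q \<bullet> d + ?L d \<bullet> q) + (?B q q \<bullet> d + (?B q d + ?B d q) \<bullet> q))) (at q)"
  proof -
    have L: "(?L has_derivative ?L) (at q)"
      by (intro bounded_linear_imp_has_derivative linear_conv_bounded_linear[THEN iffD1] linear_potential_linear)
    have B: "((\<lambda>q. ?B q q) has_derivative (\<lambda>d. ?B q d + ?B d q)) (at q)"
      by (rule bounded_bilinear.FDERIV[OF bilinear_conv_bounded_bilinear[THEN iffD1, OF bilinear_potential_bilinear]
          has_derivative_ident has_derivative_ident])
    show ?thesis
      by (intro has_derivative_add has_derivative_const has_derivative_mult_right has_derivative_inner
          has_derivative_inner_right has_derivative_ident L B)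
  qed
  have symmetric: "0 + 3 * u0\<^sup>2 * (?c \<bullet> d) + 3 * u0 * (?L q \<bullet> d + ?L d \<bullet> q) + (?B q q \<bullet> d + (?B q d + ?B d q) \<bullet> q) =
      3 * (d \<bullet> integral {a..b} (\<lambda>x. (u0 + omega a b x \<bullet> q)\<^sup>2 *\<^sub>R omega a b x))" for d
  proof -
    have "?L d \<bullet> q = ?L q \<bullet> d"
      unfolding potential_linear_def pull[OF omega_integrable(2), THEN integral_unique, symmetric]
      by (simp add: mult.commute)
    moreover have "?B q d \<bullet> q = ?B q q \<bullet> d" "?B d q \<bullet> q = ?B q q \<bullet> d"
      unfolding potential_bilinear_def pull[OF omega_integrable(3), THEN integral_unique, symmetric]
      by (simp_all add: mult_ac)
    ultimately show ?thesis
      unfolding potential_gradient_expand inner_commute[of d] inner_add_left by simp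
  qed
  show ?thesis unfolding expand using deriv by (simp only: symmetric)
qed

definition hamiltonian_gradient ::
    "real \<Rightarrow> real \<Rightarrow> real \<Rightarrow> real^(2 \<times> 'n::{finite,linorder} \<times> 2) \<Rightarrow> real^(2 \<times> 'n::{finite,linorder} \<times> 2)" where
  "hamiltonian_gradient a b u0 y =
     join_qp (((Dmat a b ** Dmat a b) \<otimes>\<^sub>K mat 1) *v q_part y +
         integral {a..b} (\<lambda>x. (u0 + omega a b x \<bullet> q_part y)\<^sup>2 *\<^sub>R omega a b x))
       (p_part y)"

lemma GDERIV_hamiltonian:
  fixes y :: "real^(2 \<times> 'n::{finite,linorder} \<times> 2)"
  shows "GDERIV (hamiltonian a b u0) y :> hamiltonian_gradient a b u0 y"
proof -
  define M :: "real^('n \<times> 2)^('n \<times> 2)" where "M = (Dmat a b ** Dmat a b) \<otimes>\<^sub>K mat 1"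
  define V :: "real^('n \<times> 2)" where "V = integral {a..b} (\<lambda>x. (u0 + omega a b x \<bullet> q_part y)\<^sup>2 *\<^sub>R omega a b x)"
  have q: "(q_part has_derivative q_part) (at y)" and p: "(p_part has_derivative p_part) (at y)"
    by (intro bounded_linear_imp_has_derivative linear_conv_bounded_linear[THEN iffD1] linear_q_part linear_p_part)+
  have M: "((\<lambda>y. M *v q_part y) has_derivative (\<lambda>d. M *v q_part d)) (at y)"
    by (rule has_derivative_compose[OF q bounded_linear_imp_has_derivative[OF matrix_vector_mul_bounded_linear]])
  have M_sym: "q \<bullet> (M *v q') = (M *v q) \<bullet> q'" for q q' unfolding M_def by (rule Dmat_squared_symmetric)
  have "((\<lambda>y. 1 / 2 * (p_part y \<bullet> p_part y + q_part y \<bullet> (M *v q_part y) +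
      2 / 3 * integral {a..b} (\<lambda>x. (u0 + omega a b x \<bullet> q_part y) ^ 3))) has_derivative
      (\<lambda>d. 1 / 2 * ((p_part y \<bullet> p_part d + p_part d \<bullet> p_part y) +
        (q_part y \<bullet> (M *v q_part d) + q_part d \<bullet> (M *v q_part y)) + 2 / 3 * (3 * (q_part d \<bullet> V))))) (at y)"
    unfolding V_def
    by (intro has_derivative_mult_right has_derivative_add has_derivative_inner q p M
        has_derivative_compose[OF q potential_has_derivative[of a b u0 "q_part y"]])
  moreover have "1 / 2 * ((p_part y \<bullet> p_part d + p_part d \<bullet> p_part y) +
        (q_part y \<bullet> (M *v q_part d) + q_part d \<bullet> (M *v q_part y)) + 2 / 3 * (3 * (q_part d \<bullet> V))) =
      d \<bullet> hamiltonian_gradient a b u0 y" for d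
    unfolding inner_commute[of d] hamiltonian_gradient_def inner_join_qp M_def[symmetric] V_def[symmetric]
    by (simp add: M_sym[of "q_part y"] inner_add_left inner_commute[of "q_part d"] inner_commute[of "p_part d"])
  ultimately show ?thesis
    unfolding gderiv_def hamiltonian_def[abs_def] Let_def M_def[symmetric] by simp
qed

lemma linear_join_qp: "linear f \<Longrightarrow> linear g \<Longrightarrow> linear (\<lambda>y. join_qp (f y) (g y))"
  by (auto simp: linear_iff join_qp_def vec_eq_iff)

lemma quadratic_map_hamiltonian_gradient:
  "quadratic_map (hamiltonian_gradient a b u0 :: real^(2 \<times> 'n::{finite,linorder} \<times> 2) \<Rightarrow> _)"
proof -
  let ?w = "join_qp (u0\<^sup>2 *\<^sub>R potential_vector a b) (0 :: real^('n \<times> 2))"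
  let ?L = "\<lambda>y :: real^(2 \<times> 'n \<times> 2). join_qp (((Dmat a b ** Dmat a b) \<otimes>\<^sub>K mat 1) *v q_part y +
      (2 * u0) *\<^sub>R potential_linear a b (q_part y)) (p_part y)"
  let ?B = "\<lambda>y y' :: real^(2 \<times> 'n \<times> 2). join_qp (potential_bilinear a b (q_part y) (q_part y')) 0"
  have "linear ?L"
    by (intro linear_join_qp linear_compose_add linear_compose_scale_right linear_p_part
        linear_compose[OF linear_q_part matrix_vector_mul_linear, unfolded o_def]
        linear_compose[OF linear_q_part linear_potential_linear, unfolded o_def])
  moreover have "bilinear ?B"
  proof -
    have "linear (potential_bilinear a b q)" "linear (\<lambda>q. potential_bilinear a b q q')"
      for q q' :: "real^('n \<times> 2)"
      using bilinear_potential_bilinear by (auto simp: bilinear_def)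
    from this[THEN linear_compose[OF linear_q_part, unfolded o_def]]
    show ?thesis unfolding bilinear_def by (auto intro!: linear_join_qp simp: linear_iff[of "\<lambda>_. 0"])
  qed
  moreover have "hamiltonian_gradient a b u0 = (\<lambda>y. ?w + ?L y + ?B y y)"
    by (auto simp: hamiltonian_gradient_def potential_gradient_expand join_qp_def vec_eq_iff fun_eq_iff)
  ultimately show ?thesis
    unfolding quadratic_map_def linear_conv_bounded_linear bilinear_conv_bounded_bilinear by blast
qed

lemma ham_field_eq:
  "ham_field a b u0 y = (absJ2 \<otimes>\<^sub>K Dmat a b \<otimes>\<^sub>K transpose J2) *v hamiltonian_gradient a b u0 y"
  unfolding ham_field_def gradient_eqI[OF GDERIV_hamiltonian] ..

lemma ham_field_explicit_eq: "ham_field a b u0 = ham_field_explicit a b u0"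
  by (rule ext)
     (simp add: ham_field_eq hamiltonian_gradient_def absJ2_kronecker_join_qp ham_field_explicit_def Let_def)

theorem corollary1:
  fixes a b u0 :: real and s k :: nat
    and H :: "real^(2 \<times> 'n::{finite,linorder} \<times> 2) \<Rightarrow> real"
    and f :: "real^(2 \<times> 'n::{finite,linorder} \<times> 2) \<Rightarrow> real^(2 \<times> 'n::{finite,linorder} \<times> 2)"
  assumes "a < b" and "1 \<le> s" and "real k \<ge> 3 / 2 * real s"
    and "H = hamiltonian a b u0" and "f = ham_field a b u0"
  shows "f = ham_field_explicit a b u0
    \<and> rk_conserves k (hbvm_A k s) (hbvm_b k) f H
    \<and> rk_has_order k (hbvm_A k s) (hbvm_b k) f (2 * s)"
proof (intro conjI)
  have "3 * s \<le> 2 * k" using assms(3) by linarith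
  have f: "f = (\<lambda>y. (absJ2 \<otimes>\<^sub>K Dmat a b \<otimes>\<^sub>K transpose J2) *v hamiltonian_gradient a b u0 y)"
    by (simp add: assms(5) ham_field_eq fun_eq_iff)
  show "f = ham_field_explicit a b u0" unfolding assms(5) by (rule ham_field_explicit_eq)
  show "rk_conserves k (hbvm_A k s) (hbvm_b k) f H"
    unfolding f assms(4)
    by (rule hbvm_conserves_cubic[OF \<open>1 \<le> s\<close> \<open>3 * s \<le> 2 * k\<close>
          quadratic_map_hamiltonian_gradient GDERIV_hamiltonian
          matrix_vector_mul_linear skew_structure_matrix])
  show "rk_has_order k (hbvm_A k s) (hbvm_b k) f (2 * s)"
    unfolding f
    by (rule hbvm_order_quadratic[OF quadratic_map_compose_linear[OF
          quadratic_map_hamiltonian_gradient matrix_vector_mul_bounded_linear]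
          \<open>1 \<le> s\<close> \<open>3 * s \<le> 2 * k\<close>])
qed

end
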